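(* Every uniform chain $A$ of rank $\omega$ has a representation of the form $\mathcal A(\sigma,\pi)$ for some compatible pair $(\sigma,\pi)$. In particular, a uniform chain $A$ of rank $\omega$ is isomorphic to $\mathcal A(\sigma,\pi)$ whenever $\sigma=\sigma^{A,x}$ and $\pi=\pi^{A,x}$ for some $x\in A$.
   Context: A chain is a linearly ordered set; $\cong$ is order isomorphism. $A+B$ is the ordered sum, $AB=\sum_{b\in B}A$ the anti-lexicographic product; $1$ is the one-element chain. For a chain $A$ define equivalence relations $\rho_\alpha$: $\rho_0$ is equality; $A/\alpha$ is the quotient chain of classes $[x]_\alpha$ (the $\alpha$-components); $x\rho_{\alpha+1}y$ iff the interval between $[x]_\alpha$ and $[y]_\alpha$ in $A/\alpha$ is finite; for limit $\alpha$, $x\rho_\alpha y$ iff $x\rho_\beta y$ for some $\beta<\alpha$. $\mathrm{rk}(A)$ is the least $\alpha$ with $A/\alpha\cong1$. $A$ is uniform if $A^{\ge x}=\{y\in A:x\le y\}$ has the same order type for all $x\in A$. $\mathcal S(\alpha)$ is the set of sequences $s:\alpha\to\alpha$ with $s(i)\le i$ for all $i<\alpha$; $s\restriction k$ is restriction and $t^\frown a$ is $t$ with the entry $a$ appended. For $s\in\mathcal S(n+1)$, $n\ge1$: $s^-=s\restriction n$, and $s^+$ is $s$ with the next-to-last entry $s(n-1)$ deleted (in $\mathcal S(n)$ iff $s(n)<n$). Put $\mathcal A(\langle0\rangle)=1$, $\mathcal A(s)=\mathcal A(s^-)\mathbb Z$ if $s(n)=n$, and $\mathcal A(s)=\mathcal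 A(s^+)+\mathcal A(s^-)\mathbb N$ if $s(n)<n$. By Pastijn's theorem the chains $\mathcal A(s)$, $s\in\mathcal S(n+1)$, exhaust the uniform chains of rank $n$ up to isomorphism. Compatible pairs: let $\sigma\in\mathcal S(\omega+1)$ and $\pi:\omega\to\omega+1$. For $n\in\omega$ let $w_n$ be the least $v$ with $n\le v<\omega$ and $\pi(v)>0$ if such $v$ exists, and $w_n=\omega$ otherwise. The pair $(\sigma,\pi)$ is compatible if (i) for all $k\in\omega$, $\sigma(k)=k$ iff $\pi(k)=\omega$; and (ii) for every $n\in\omega$ with $\pi(n)=0$, $\sigma(w_n)\le n$. The sequence $(s_n)_{n\in\omega}$ derived from $(\sigma,\pi)$ is given by $s_n=\sigma\restriction(n+1)$ if $\pi(n)>0$, and $s_n=(\sigma\restriction n)^\frown\sigma(w_n)$ if $\pi(n)=0$. For a compatible pair $(\sigma,\pi)$ with derived sequence $(s_n)_n$, $\mathcal A(\sigma,\pi)$ denotes the uniform chain of rank $\omega$ obtained as the union (direct limit) of the chains $A_n=\mathcal A(s_n)$ along embeddings $A_n\to A_{n+1}$ mapping $A_n$ isomorphically onto an $n$-component of $A_{n+1}$, as follows: if $\pi(n)<\omega$, then $A_{n+1}/n\cong\mathbb N$ and $A_n$ is mapped onto the $n$-component having exactly $\pi(n)$ predecessor $n$-components in $A_{n+1}$; if $\pi(n)=\omega$, then $A_{n+1}/n\cong\mathbb Z$ and $A_n$ is mapped onto the $0$th $n$-component. For a uniform chain $A$ of rank $\omega$ and $x\in A$: let $s_n\in\mathcal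 S(n+1)$ be such that $[x]_n\cong\mathcal A(s_n)$. The embedding sequence $\pi^{A,x}$ has $\pi^{A,x}(n)=i\in\omega$ if $[x]_{n+1}/n\cong\mathbb N$ and $[x]_n$ has exactly $i$ predecessor $n$-components in $[x]_{n+1}$, and $\pi^{A,x}(n)=\omega$ otherwise (i.e. if $[x]_{n+1}/n\cong\mathbb Z$). The trunk $\sigma^{A,x}\in\mathcal S(\omega+1)$ is given by $\sigma^{A,x}\restriction\omega=\bigcup_n s_{n+1}^-$, with $\sigma^{A,x}(\omega)=s_m(m)$ where $m$ is minimal with $\pi^{A,x}(n)=0$ for all $n\ge m$ if such $m$ exists, and $\sigma^{A,x}(\omega)=\omega$ otherwise.
   Formalization: Compatibility condition (i) is corrected to "σ(w_{k+1})=k+1 iff π(k)=ω" for all k; as stated, σ(0)=0 would force π(0)=ω, so every A(σ,π) would contain a copy of Z and the uniform chain ω^ω of rank ω would have no representation. *)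

theory Defs
  imports Complex_Main "HOL-Library.Extended_Nat"
begin

(* A chain is a relation r with "Linear_order r", its underlying set being "Field r"; the subchain
   on C is "Restr r C".  Ordinals up to omega are elements of enat, with \<infinity> for omega; an element
   of omega + 1 is thus exactly an enat. *)

section \<open>Chains\<close>

(* By iso_iff2, "iso r r' f" means that f is an order isomorphism, also when r, r' are not
   well-orders. *)
definition chain_iso :: "'a rel \<Rightarrow> 'b rel \<Rightarrow> bool" (infix "\<simeq>" 50) where
  "r \<simeq> r' \<longleftrightarrow> (\<exists>f. iso r r' f)"

definition one_chain :: "unit rel" where
  "one_chain = {((), ())}"

definition int_chain :: "int rel" where
  "int_chain = {(i, j). i \<le> j}"

definition chain_plus :: "'a rel \<Rightarrow> 'b rel \<Rightarrow> ('a + 'b) rel" where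
  "chain_plus A B = {(Inl a, Inl a') | a a'. (a, a') \<in> A} \<union> {(Inr b, Inr b') | b b'. (b, b') \<in> B}
     \<union> {(Inl a, Inr b) | a b. a \<in> Field A \<and> b \<in> Field B}"

(* Anti-lexicographic product: the second coordinate is the dominant one. *)
definition chain_times :: "'a rel \<Rightarrow> 'b rel \<Rightarrow> ('a \<times> 'b) rel" where
  "chain_times A B = {((a, b), (a', b')) | a b a' b'. a \<in> Field A \<and> a' \<in> Field A \<and>
     (b, b') \<in> B \<and> (b = b' \<longrightarrow> (a, a') \<in> A)}"

definition uniform_chain :: "'a rel \<Rightarrow> bool" where
  "uniform_chain r \<longleftrightarrow> (\<forall>x\<in>Field r. \<forall>y\<in>Field r. Restr r (above r x) \<simeq> Restr r (above r y))"

section \<open>Components and rank\<close>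

(* When E is an equivalence with convex classes, this is the quotient chain of r by E. *)
definition quot :: "'a rel \<Rightarrow> 'a rel \<Rightarrow> 'a set rel" where
  "quot r E = {(X, Y). X \<in> Field r // E \<and> Y \<in> Field r // E \<and> (\<exists>x\<in>X. \<exists>y\<in>Y. (x, y) \<in> r)}"

definition between :: "'a rel \<Rightarrow> 'a \<Rightarrow> 'a \<Rightarrow> 'a set" where
  "between r x y = {z. (x, z) \<in> r \<and> (z, y) \<in> r \<or> (y, z) \<in> r \<and> (z, x) \<in> r}"

primrec rho_nat :: "'a rel \<Rightarrow> nat \<Rightarrow> 'a rel" where
  "rho_nat r 0 = Id_on (Field r)"
| "rho_nat r (Suc n) = {(x, y). x \<in> Field r \<and> y \<in> Field r \<and>
     finite (between (quot r (rho_nat r n)) (rho_nat r n `` {x}) (rho_nat r n `` {y}))}"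

definition rho :: "'a rel \<Rightarrow> enat \<Rightarrow> 'a rel" where
  "rho r \<alpha> = (case \<alpha> of enat n \<Rightarrow> rho_nat r n | \<infinity> \<Rightarrow> (\<Union>n. rho_nat r n))"

definition component :: "'a rel \<Rightarrow> enat \<Rightarrow> 'a \<Rightarrow> 'a set" where
  "component r \<alpha> x = rho r \<alpha> `` {x}"

definition quot_chain :: "'a rel \<Rightarrow> enat \<Rightarrow> 'a set rel" where
  "quot_chain r \<alpha> = quot r (rho r \<alpha>)"

definition has_rank :: "'a rel \<Rightarrow> enat \<Rightarrow> bool" where
  "has_rank r \<alpha> \<longleftrightarrow> quot_chain r \<alpha> \<simeq> one_chain \<and> (\<forall>\<beta><\<alpha>. \<not> quot_chain r \<beta> \<simeq> one_chain)"

section \<open>The chains of finite rank\<close>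

(* seqs k is S(k) for finite k; such a sequence is the list of its values. *)
definition seqs :: "nat \<Rightarrow> nat list set" where
  "seqs k = {s. length s = k \<and> (\<forall>i<k. s ! i \<le> i)}"

definition sminus :: "nat list \<Rightarrow> nat list" where
  "sminus s = butlast s"

definition splus :: "nat list \<Rightarrow> nat list" where
  "splus s = butlast (butlast s) @ [last s]"

(* A common type carrying all chains A(s).  Origin is the point of A(<0>); InZ embeds A(s^-) Z;
   InL and InR embed the two summands of A(s^+) + A(s^-) N. *)
datatype point = Origin | InZ point int | InL point | InR point nat

function fin_chain :: "nat list \<Rightarrow> point rel" where
  "fin_chain s =
     (if length s \<le> 1 then {(Origin, Origin)}
      else if last s = length s - 1
      then dir_image (chain_times (fin_chain (sminus s)) int_chain) (\<lambda>(a, k). InZ a k)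
      else dir_image (chain_plus (fin_chain (splus s)) (chain_times (fin_chain (sminus s)) natLeq))
             (case_sum InL (\<lambda>(a, k). InR a k)))"
  by pat_completeness auto
termination
  by (relation "measure length") (auto simp: sminus_def splus_def)

declare fin_chain.simps [simp del]

section \<open>Compatible pairs\<close>

definition seqs_omega1 :: "(enat \<Rightarrow> enat) set" where
  "seqs_omega1 = {\<sigma>. \<forall>i. \<sigma> i \<le> i}"

definition next_pos :: "(nat \<Rightarrow> enat) \<Rightarrow> nat \<Rightarrow> enat" where
  "next_pos \<pi> n = (if \<exists>v\<ge>n. \<pi> v > 0 then enat (LEAST v. n \<le> v \<and> \<pi> v > 0) else \<infinity>)"

(* The second conjunct says that s_{k+1}(k+1) = k+1 iff \<pi>(k) = \<omega>, where (s_n) is the derived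
   sequence below: s_n(n) = \<sigma>(w_n) for every n, because w_n = n if \<pi>(n) > 0.  This is what makes
   A_{k+1}/k isomorphic to Z exactly when \<pi>(k) = \<omega>, as the definition of A(\<sigma>,\<pi>) presupposes.
   The condition "\<sigma>(k) = k iff \<pi>(k) = \<omega>", with which compatibility is sometimes stated, does not
   express this: at k = 0 it reduces to \<pi>(0) = \<omega> (as \<sigma>(0) = 0 always), which would leave out every
   chain with 1-components of type N, such as the ordinal \<omega>^\<omega>.  Replacing it by
   "\<sigma>(k+1) = k+1 iff \<pi>(k) = \<omega>" is not enough either, because \<sigma>(k+1) is not the last entry of
   s_{k+1} if \<pi>(k+1) = 0. *)
definition compatible :: "(enat \<Rightarrow> enat) \<Rightarrow> (nat \<Rightarrow> enat) \<Rightarrow> bool" where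
  "compatible \<sigma> \<pi> \<longleftrightarrow> \<sigma> \<in> seqs_omega1 \<and>
     (\<forall>k. \<sigma> (next_pos \<pi> (Suc k)) = enat (Suc k) \<longleftrightarrow> \<pi> k = \<infinity>) \<and>
     (\<forall>n. \<pi> n = 0 \<longrightarrow> \<sigma> (next_pos \<pi> n) \<le> enat n)"

(* For a compatible pair, the_enat is only applied to finite values here. *)
definition derived :: "(enat \<Rightarrow> enat) \<Rightarrow> (nat \<Rightarrow> enat) \<Rightarrow> nat \<Rightarrow> nat list" where
  "derived \<sigma> \<pi> n =
     (if \<pi> n > 0 then map (\<lambda>i. the_enat (\<sigma> (enat i))) [0..<Suc n]
      else map (\<lambda>i. the_enat (\<sigma> (enat i))) [0..<n] @ [the_enat (\<sigma> (next_pos \<pi> n))])"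

section \<open>The chain of a compatible pair\<close>

primrec push :: "(nat \<Rightarrow> 'a \<Rightarrow> 'a) \<Rightarrow> nat \<Rightarrow> nat \<Rightarrow> 'a \<Rightarrow> 'a" where
  "push e m 0 x = x"
| "push e m (Suc d) x = e (m + d) (push e m d x)"

(* The direct limit of A 0, A 1, ... along the maps e n from A n to A (Suc n). *)
definition dir_lim :: "(nat \<Rightarrow> 'a rel) \<Rightarrow> (nat \<Rightarrow> 'a \<Rightarrow> 'a) \<Rightarrow> (nat \<times> 'a) set rel" where
  "dir_lim A e = quot
     {((m, x), (n, y)) | m x n y. x \<in> Field (A m) \<and> y \<in> Field (A n) \<and>
        (\<exists>k. m \<le> k \<and> n \<le> k \<and> (push e m (k - m) x, push e n (k - n) y) \<in> A k)}
     {((m, x), (n, y)) | m x n y. x \<in> Field (A m) \<and> y \<in> Field (A n) \<and>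
        (\<exists>k. m \<le> k \<and> n \<le> k \<and> push e m (k - m) x = push e n (k - n) y)}"

(* If \<pi> n = \<infinity>, then A (Suc n) = A(t^-) Z for t = derived \<sigma> \<pi> (Suc n), and the 0th n-component is
   the copy of A(t^-) with index 0. *)
definition embedding_system :: "(enat \<Rightarrow> enat) \<Rightarrow> (nat \<Rightarrow> enat) \<Rightarrow> (nat \<Rightarrow> point \<Rightarrow> point) \<Rightarrow> bool" where
  "embedding_system \<sigma> \<pi> e \<longleftrightarrow> (\<forall>n.
     let A = fin_chain (derived \<sigma> \<pi> n);
         B = fin_chain (derived \<sigma> \<pi> (Suc n));
         Q = quot_chain B (enat n);
         C = e n ` Field A
     in C \<in> Field B // rho B (enat n) \<and> iso A (Restr B C) (e n) \<and>
        (\<pi> n < \<infinity> \<longrightarrow> Q \<simeq> natLeq \<and> finite (underS Q C) \<and> enat (card (underS Q C)) = \<pi> n) \<and>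
        (\<pi> n = \<infinity> \<longrightarrow> Q \<simeq> int_chain \<and>
           C = (\<lambda>a. InZ a 0) ` Field (fin_chain (sminus (derived \<sigma> \<pi> (Suc n))))))"

(* The embeddings are prescribed only up to automorphisms of the A_n; any choice gives the same
   direct limit up to isomorphism. *)
definition pair_chain :: "(enat \<Rightarrow> enat) \<Rightarrow> (nat \<Rightarrow> enat) \<Rightarrow> (nat \<times> point) set rel" where
  "pair_chain \<sigma> \<pi> =
     dir_lim (\<lambda>n. fin_chain (derived \<sigma> \<pi> n)) (SOME e. embedding_system \<sigma> \<pi> e)"

section \<open>Embedding sequence and trunk of a point\<close>

definition type_seq :: "'a rel \<Rightarrow> 'a \<Rightarrow> nat \<Rightarrow> nat list" where
  "type_seq r x n = (SOME s. s \<in> seqs (Suc n) \<and> Restr r (component r (enat n) x) \<simeq> fin_chain s)"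

definition emb_seq :: "'a rel \<Rightarrow> 'a \<Rightarrow> nat \<Rightarrow> enat" where
  "emb_seq r x n =
     (let Q = quot_chain (Restr r (component r (enat (Suc n)) x)) (enat n)
      in if Q \<simeq> natLeq then enat (card (underS Q (component r (enat n) x))) else \<infinity>)"

(* The sequences s_{n+1}^- extend one another, so the entry of their union at k can be read off
   from n = k. *)
definition trunk :: "'a rel \<Rightarrow> 'a \<Rightarrow> enat \<Rightarrow> enat" where
  "trunk r x i = (case i of
     enat k \<Rightarrow> enat (sminus (type_seq r x (Suc k)) ! k)
   | \<infinity> \<Rightarrow> (if \<exists>m. \<forall>n\<ge>m. emb_seq r x n = 0
           then (let m = (LEAST m. \<forall>n\<ge>m. emb_seq r x n = 0) in enat (type_seq r x m ! m))
           else \<infinity>))"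

end

theory Submission
  imports Defs
begin

text \<open>
  Let \<open>r\<close> be a uniform chain of rank \<open>\<omega>\<close>. Its \<open>n\<close>-components are the classes of \<open>\<rho>\<^sub>n\<close>; every
  isomorphism between final segments of \<open>r\<close> respects all the \<open>\<rho>\<^sub>n\<close>, because these depend only on
  intervals (\<open>rho_convex_emb\<close>).

  If some \<open>n\<close>-component had no next \<open>n\<close>-component in its \<open>(n + 1)\<close>-component, then by uniformity none
  would have, and the rank would be at most \<open>n\<close> (\<open>next_component\<close>). So each \<open>(n + 1)\<close>-component is a sum
  of \<open>n\<close>-components over \<open>\<nat>\<close> or \<open>\<int>\<close> (\<open>component_grading\<close>). Any two \<open>n\<close>-components with a predecessor are
  isomorphic, since final segments starting in their predecessors are (\<open>nf_iso\<close>); only the first summand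
  of a sum over \<open>\<nat>\<close> may be different. This matches the recursion for the chains \<open>\<A>(s)\<close>, so by induction
  every \<open>n\<close>-component is isomorphic to some \<open>\<A>(s)\<close> with \<open>s \<in> \<S>(n + 1)\<close> (\<open>component_sequence\<close>), and \<open>s\<close> is
  unique, because the summands from which \<open>\<A>(s)\<close> is formed are its \<open>(n - 1)\<close>-components
  (\<open>fin_chain_ranked_grading\<close>, \<open>fin_chain_unique\<close>).

  Let \<open>s\<^sub>n\<close> be the sequence of the \<open>n\<close>-component of a fixed point \<open>x\<close> and \<open>\<pi>\<close> the embedding sequence of
  \<open>x\<close>. Then \<open>s\<^sub>n\<close> is \<open>s\<^sub>n\<^sub>+\<^sub>1\<^sup>-\<close> or \<open>s\<^sub>n\<^sub>+\<^sub>1\<^sup>+\<close> according to whether \<open>\<pi>(n) > 0\<close> or not (\<open>type_seq_step\<close>), and from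
  this alone it follows that trunk and embedding sequence are compatible with derived sequence \<open>(s\<^sub>n)\<close>:
  the last entry of \<open>s\<^sub>n\<close> stays the last one as long as \<open>\<pi> = 0\<close> and then becomes an entry of the trunk
  (\<open>\<sigma>_next_pos\<close>). Finally, for any system of embeddings of the \<open>\<A>(s\<^sub>n)\<close> of the prescribed kind, one chooses
  isomorphisms from \<open>\<A>(s\<^sub>n)\<close> to the \<open>n\<close>-component of \<open>x\<close> that commute with the embeddings: a given
  isomorphism is prolonged by arbitrary isomorphisms of the remaining summands (\<open>extend_iso\<close>). They induce
  an isomorphism from the direct limit to the union of the components of \<open>x\<close>, which is \<open>r\<close>.
\<close>


section \<open>Linear orders and their isomorphisms\<close>

lemma lin_refl: "Linear_order r \<Longrightarrow> x \<in> Field r \<Longrightarrow> (x, x) \<in> r"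
  by (auto simp: order_on_defs refl_on_def)

lemma lin_trans: "Linear_order r \<Longrightarrow> (x, y) \<in> r \<Longrightarrow> (y, z) \<in> r \<Longrightarrow> (x, z) \<in> r"
  by (auto simp: order_on_defs dest: transD)

lemma lin_antisym: "Linear_order r \<Longrightarrow> (x, y) \<in> r \<Longrightarrow> (y, x) \<in> r \<Longrightarrow> x = y"
  by (auto simp: order_on_defs dest: antisymD)

lemma lin_total: "Linear_order r \<Longrightarrow> x \<in> Field r \<Longrightarrow> y \<in> Field r \<Longrightarrow> (x, y) \<in> r \<or> (y, x) \<in> r"
  by (cases "x = y") (auto simp: order_on_defs total_on_def refl_on_def)

lemma lin_not: "Linear_order r \<Longrightarrow> x \<in> Field r \<Longrightarrow> y \<in> Field r \<Longrightarrow> (x, y) \<notin> r \<Longrightarrow> (y, x) \<in> r"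
  using lin_total by metis

lemma linI:
  assumes "\<And>x. x \<in> Field r \<Longrightarrow> (x, x) \<in> r"
    and "\<And>x y z. (x, y) \<in> r \<Longrightarrow> (y, z) \<in> r \<Longrightarrow> (x, z) \<in> r"
    and "\<And>x y. (x, y) \<in> r \<Longrightarrow> (y, x) \<in> r \<Longrightarrow> x = y"
    and "\<And>x y. x \<in> Field r \<Longrightarrow> y \<in> Field r \<Longrightarrow> (x, y) \<in> r \<or> (y, x) \<in> r"
  shows "Linear_order r"
  unfolding order_on_defs refl_on_def total_on_def trans_def antisym_def
  using assms by (auto intro: FieldI1 FieldI2)

lemma lin_Restr: "Linear_order r \<Longrightarrow> Linear_order (Restr r C)"
  by (rule Linear_order_Restr)

lemma Field_Restr: "Linear_order r \<Longrightarrow> Field (Restr r C) = Field r \<inter> C"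
  by (auto simp: Field_def order_on_defs refl_on_def)

lemma isoI:
  assumes "bij_betw f (Field r) (Field r')"
    and "\<And>a b. a \<in> Field r \<Longrightarrow> b \<in> Field r \<Longrightarrow> (a, b) \<in> r \<longleftrightarrow> (f a, f b) \<in> r'"
  shows "iso r r' f"
  using assms by (simp add: iso_iff2)

lemma iso_bij: "iso r r' f \<Longrightarrow> bij_betw f (Field r) (Field r')"
  by (simp add: iso_iff2)

lemma iso_le: "iso r r' f \<Longrightarrow> a \<in> Field r \<Longrightarrow> b \<in> Field r \<Longrightarrow> (f a, f b) \<in> r' \<longleftrightarrow> (a, b) \<in> r"
  by (simp add: iso_iff2)

lemma iso_in: "iso r r' f \<Longrightarrow> a \<in> Field r \<Longrightarrow> f a \<in> Field r'"
  using iso_bij bij_betwE by metis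

lemma iso_eq: "iso r r' f \<Longrightarrow> a \<in> Field r \<Longrightarrow> b \<in> Field r \<Longrightarrow> f a = f b \<longleftrightarrow> a = b"
  using iso_bij bij_betw_imp_inj_on inj_on_eq_iff by metis

lemma iso_surj: "iso r r' f \<Longrightarrow> b \<in> Field r' \<Longrightarrow> \<exists>a\<in>Field r. b = f a"
  using iso_bij bij_betw_imp_surj_on by blast

lemma iso_refl: "iso r r id"
  by (simp add: iso_iff2)

lemma iso_inv:
  assumes "iso r r' f"
  shows "iso r' r (inv_into (Field r) f)"
proof (rule isoI)
  note b = iso_bij[OF assms]
  show "bij_betw (inv_into (Field r) f) (Field r') (Field r)" by (rule bij_betw_inv_into[OF b])
  fix c d assume "c \<in> Field r'" "d \<in> Field r'"
  then obtain a e where "a \<in> Field r" "c = f a" "e \<in> Field r" "d = f e"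
    using iso_surj[OF assms] by blast
  then show "(c, d) \<in> r' \<longleftrightarrow> (inv_into (Field r) f c, inv_into (Field r) f d) \<in> r"
    using b assms by (simp add: bij_betw_inv_into_left iso_le)
qed

lemma iso_comp: "iso r r' f \<Longrightarrow> iso r' r'' g \<Longrightarrow> iso r r'' (g \<circ> f)"
  by (rule isoI) (auto intro: bij_betw_trans iso_bij simp: iso_le iso_in)

lemma chain_isoI: "iso r r' f \<Longrightarrow> r \<simeq> r'"
  by (auto simp: chain_iso_def)

lemma chain_iso_refl: "r \<simeq> r"
  using iso_refl by (auto simp: chain_iso_def)

lemma chain_iso_sym: "r \<simeq> r' \<Longrightarrow> r' \<simeq> r"
  using iso_inv by (auto simp: chain_iso_def)

lemma chain_iso_trans: "r \<simeq> r' \<Longrightarrow> r' \<simeq> r'' \<Longrightarrow> r \<simeq> r''"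
  unfolding chain_iso_def by (blast intro: iso_comp)

lemma iso_Restr:
  assumes "iso r r' f" "Linear_order r" "Linear_order r'" "C \<subseteq> Field r" "C' = f ` C"
  shows "iso (Restr r C) (Restr r' C') f"
proof (rule isoI)
  have "f ` C \<subseteq> Field r'" using assms(1,4) iso_in by fastforce
  then show "bij_betw f (Field (Restr r C)) (Field (Restr r' C'))"
    using assms iso_bij[OF assms(1)]
    by (auto simp: Field_Restr Int_absorb1 bij_betw_def intro: inj_on_subset)
qed (use assms in \<open>auto simp: Field_Restr iso_le\<close>)

section \<open>Condensations\<close>

text \<open>An equivalence relation on a chain whose classes are convex.\<close>

definition condensation :: "'a rel \<Rightarrow> 'a rel \<Rightarrow> bool" where
  "condensation r E \<longleftrightarrow> equiv (Field r) E \<and>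
     (\<forall>x y z. (x, y) \<in> r \<longrightarrow> (y, z) \<in> r \<longrightarrow> (x, z) \<in> E \<longrightarrow> (x, y) \<in> E)"

lemma cond_equiv: "condensation r E \<Longrightarrow> equiv (Field r) E"
  by (simp add: condensation_def)

lemma cond_conv: "condensation r E \<Longrightarrow> (x, y) \<in> r \<Longrightarrow> (y, z) \<in> r \<Longrightarrow> (x, z) \<in> E \<Longrightarrow> (x, y) \<in> E"
  by (auto simp: condensation_def)

lemma cond_Field: "condensation r E \<Longrightarrow> (x, y) \<in> E \<Longrightarrow> x \<in> Field r \<and> y \<in> Field r"
  by (auto dest!: cond_equiv equiv_type)

lemma cond_refl: "condensation r E \<Longrightarrow> x \<in> Field r \<Longrightarrow> (x, x) \<in> E"
  by (auto dest!: cond_equiv simp: equiv_def refl_on_def)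

lemma cond_sym: "condensation r E \<Longrightarrow> (x, y) \<in> E \<Longrightarrow> (y, x) \<in> E"
  by (auto dest!: cond_equiv simp: equiv_def dest: symD)

lemma cond_trans: "condensation r E \<Longrightarrow> (x, y) \<in> E \<Longrightarrow> (y, z) \<in> E \<Longrightarrow> (x, z) \<in> E"
  by (auto dest!: cond_equiv simp: equiv_def dest: transD)

lemma cond_conv': "condensation r E \<Longrightarrow> (x, y) \<in> r \<Longrightarrow> (y, z) \<in> r \<Longrightarrow> (x, z) \<in> E \<Longrightarrow> (y, z) \<in> E"
  by (meson cond_conv cond_sym cond_trans)

lemma cond_class_eq: "condensation r E \<Longrightarrow> x \<in> Field r \<Longrightarrow> E `` {x} = E `` {y} \<longleftrightarrow> (x, y) \<in> E"
  by (metis Image_singleton_iff cond_equiv cond_refl cond_sym equiv_class_eq)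

text \<open>Distinct classes are ordered as their elements are.\<close>

lemma cond_less:
  assumes "Linear_order r" "condensation r E" "(x, y) \<in> r" "(x, y) \<notin> E" "(x, x') \<in> E" "(y, y') \<in> E"
  shows "(x', y') \<in> r"
proof -
  have f: "x \<in> Field r" "y \<in> Field r" "x' \<in> Field r" "y' \<in> Field r"
    using assms cond_Field by metis+
  have "(x', y) \<in> r"
    by (rule ccontr) (meson assms cond_conv f lin_not[OF assms(1)])
  moreover have "(x', y) \<notin> E" using assms cond_trans by metis
  ultimately show ?thesis
    by (meson assms cond_conv cond_sym f lin_not[OF assms(1)] cond_trans)
qed

lemma quot_iff:
  assumes "Linear_order r" "condensation r E" "x \<in> Field r" "y \<in> Field r"
  shows "(E `` {x}, E `` {y}) \<in> quot r E \<longleftrightarrow> (x, y) \<in> r \<or> (x, y) \<in> E"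
proof
  assume "(E `` {x}, E `` {y}) \<in> quot r E"
  then obtain x' y' where "(x, x') \<in> E" "(y, y') \<in> E" "(x', y') \<in> r" by (auto simp: quot_def)
  then show "(x, y) \<in> r \<or> (x, y) \<in> E"
    by (meson assms cond_less cond_sym cond_trans)
next
  assume "(x, y) \<in> r \<or> (x, y) \<in> E"
  then have "\<exists>x'\<in>E `` {x}. \<exists>y'\<in>E `` {y}. (x', y') \<in> r"
    using assms cond_refl lin_refl cond_sym by (metis Image_singleton_iff)
  then show "(E `` {x}, E `` {y}) \<in> quot r E"
    using assms by (auto simp: quot_def quotient_def)
qed

lemma quot_FieldE:
  assumes "X \<in> Field (quot r E)"
  obtains x where "x \<in> Field r" "X = E `` {x}"
  using assms by (auto simp: Field_def quot_def quotient_def)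

lemma quot_FieldI:
  assumes "Linear_order r" "condensation r E" "x \<in> Field r"
  shows "E `` {x} \<in> Field (quot r E)"
  using quot_iff[OF assms assms(3)] cond_refl[OF assms(2,3)] by (auto intro: FieldI1)

lemma quot_linear:
  assumes "Linear_order r" "condensation r E"
  shows "Linear_order (quot r E)"
proof (rule linI)
  note q = quot_iff[OF assms] and ce = cond_class_eq[OF assms(2)]
  fix X assume "X \<in> Field (quot r E)"
  then show "(X, X) \<in> quot r E"
    by (elim quot_FieldE) (simp add: q assms lin_refl)
  fix Y assume "Y \<in> Field (quot r E)"
  with \<open>X \<in> _\<close> show "(X, Y) \<in> quot r E \<or> (Y, X) \<in> quot r E"
    by (elim quot_FieldE) (use lin_total[OF assms(1)] q in blast)
next
  note q = quot_iff[OF assms] and ce = cond_class_eq[OF assms(2)]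
  fix X Y Z assume *: "(X, Y) \<in> quot r E" "(Y, Z) \<in> quot r E"
  then have "X \<in> Field (quot r E)" "Y \<in> Field (quot r E)" "Z \<in> Field (quot r E)"
    by (auto intro: FieldI1 FieldI2)
  then obtain x y z where x: "x \<in> Field r" "X = E `` {x}" and y: "y \<in> Field r" "Y = E `` {y}"
    and z: "z \<in> Field r" "Z = E `` {z}"
    by (metis quot_FieldE)
  have "(x, y) \<in> r \<or> (x, y) \<in> E" "(y, z) \<in> r \<or> (y, z) \<in> E"
    using * q x y z by auto
  then have "(x, z) \<in> r \<or> (x, z) \<in> E"
    by (meson assms cond_refl cond_less cond_sym cond_trans lin_trans x y z)
  then show "(X, Z) \<in> quot r E" using q x y z by auto
next
  note q = quot_iff[OF assms] and ce = cond_class_eq[OF assms(2)]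
  fix X Y assume *: "(X, Y) \<in> quot r E" "(Y, X) \<in> quot r E"
  then have "X \<in> Field (quot r E)" "Y \<in> Field (quot r E)"
    by (auto intro: FieldI1 FieldI2)
  then obtain x y where x: "x \<in> Field r" "X = E `` {x}" and y: "y \<in> Field r" "Y = E `` {y}"
    by (metis quot_FieldE)
  have "(x, y) \<in> r \<or> (x, y) \<in> E" "(y, x) \<in> r \<or> (y, x) \<in> E"
    using * q x y by auto
  then have "(x, y) \<in> E"
    by (metis assms cond_refl cond_sym lin_antisym x(1))
  then show "X = Y" using ce x y by auto
qed

lemma between_quot:
  assumes "Linear_order r" "condensation r E" "x \<in> Field r" "y \<in> Field r"
  shows "between (quot r E) (E `` {x}) (E `` {y}) = (\<lambda>z. E `` {z}) ` between r x y"
proof (intro set_eqI iffI)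
  note q = quot_iff[OF assms(1,2)] and ce = cond_class_eq[OF assms(2)]
  fix Z assume Z: "Z \<in> between (quot r E) (E `` {x}) (E `` {y})"
  then have "Z \<in> Field (quot r E)" by (auto simp: between_def intro: FieldI1 FieldI2)
  then obtain z where z: "z \<in> Field r" "Z = E `` {z}" by (elim quot_FieldE)
  consider "(x, z) \<in> E" | "(z, y) \<in> E" | "z \<in> between r x y"
    using Z assms z cond_sym[OF assms(2)] by (auto simp: between_def q)
  then show "Z \<in> (\<lambda>z. E `` {z}) ` between r x y"
  proof cases
    case 1
    then have "Z = E `` {x}" "x \<in> between r x y"
      using ce[of z x] cond_sym[OF assms(2)] z assms lin_total[OF assms(1)] lin_refl[OF assms(1)] by (auto simp: between_def)
    then show ?thesis by blast
  next
    case 2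
    then have "Z = E `` {y}" "y \<in> between r x y"
      using ce z assms lin_total[OF assms(1)] lin_refl[OF assms(1)] by (auto simp: between_def)
    then show ?thesis by blast
  qed (use z in blast)
next
  note q = quot_iff[OF assms(1,2)]
  fix Z assume "Z \<in> (\<lambda>z. E `` {z}) ` between r x y"
  then obtain z where "z \<in> between r x y" "Z = E `` {z}" by blast
  moreover from this have "z \<in> Field r" by (auto simp: between_def intro: FieldI1)
  ultimately show "Z \<in> between (quot r E) (E `` {x}) (E `` {y})"
    using assms by (auto simp: between_def q)
qed

section \<open>The relations \<open>\<rho>\<^sub>n\<close>\<close>

lemma between_sym: "between r x y = between r y x"
  by (auto simp: between_def)

lemma between_self: "Linear_order r \<Longrightarrow> x \<in> Field r \<Longrightarrow> between r x x = {x}"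
  by (auto simp: between_def lin_refl dest: lin_antisym)

lemma between_Field: "z \<in> between r x y \<Longrightarrow> z \<in> Field r"
  by (auto simp: between_def intro: FieldI1)

lemma between_subset:
  assumes "Linear_order r" "x \<in> Field r" "y \<in> Field r" "z \<in> Field r"
  shows "between r x z \<subseteq> between r x y \<union> between r y z"
proof
  fix w assume w: "w \<in> between r x z"
  then have "w \<in> Field r" by (rule between_Field)
  then show "w \<in> between r x y \<union> between r y z"
    using w assms lin_total[OF assms(1), of w y] by (auto simp: between_def)
qed

lemma finite_image_cong:
  assumes "\<And>z w. z \<in> S \<Longrightarrow> w \<in> S \<Longrightarrow> f z = f w \<longleftrightarrow> g z = g w"
  shows "finite (f ` S) \<longleftrightarrow> finite (g ` S)"
proof -
  have *: "finite (g ` S)" if "finite (f ` S)" "\<And>z w. z \<in> S \<Longrightarrow> w \<in> S \<Longrightarrow> f z = f w \<longleftrightarrow> g z = g w"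
    for f :: "'a \<Rightarrow> 'x" and g :: "'a \<Rightarrow> 'y"
  proof -
    have "g ` S \<subseteq> (g \<circ> inv_into S f) ` (f ` S)"
      using that(2) by (auto simp: image_iff) (metis f_inv_into_f imageI inv_into_into)
    then show ?thesis using that(1) finite_surj by blast
  qed
  show ?thesis using *[of f g] *[of g f] assms by blast
qed

lemma rho_Suc_aux:
  assumes "Linear_order r" "condensation r (rho_nat r n)"
  shows "(x, y) \<in> rho_nat r (Suc n) \<longleftrightarrow> x \<in> Field r \<and> y \<in> Field r \<and>
    finite ((\<lambda>z. rho_nat r n `` {z}) ` between r x y)"
  using between_quot[OF assms] by auto

lemma rho_cond:
  assumes "Linear_order r"
  shows "condensation r (rho_nat r n)"
proof (induction n)
  case 0
  then show ?case
    using assms unfolding condensation_def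
    by (auto simp: equiv_def refl_on_def sym_def trans_def Id_on_def dest: lin_antisym intro: FieldI1)
next
  case (Suc n)
  let ?f = "\<lambda>z. rho_nat r n `` {z}"
  note S = rho_Suc_aux[OF assms Suc]
  have "refl_on (Field r) (rho_nat r (Suc n))"
    using S by (auto simp: refl_on_def between_self[OF assms])
  moreover have "sym (rho_nat r (Suc n))"
    using S between_sym by (metis symI)
  moreover have "trans (rho_nat r (Suc n))"
  proof (rule transI)
    fix x y z assume "(x, y) \<in> rho_nat r (Suc n)" "(y, z) \<in> rho_nat r (Suc n)"
    then show "(x, z) \<in> rho_nat r (Suc n)"
      unfolding S using between_subset[OF assms, of x y z]
      by (metis finite_UnI finite_subset image_Un image_mono)
  qed
  moreover have "(x, y) \<in> rho_nat r (Suc n)"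
    if "(x, y) \<in> r" "(y, z) \<in> r" "(x, z) \<in> rho_nat r (Suc n)" for x y z
  proof -
    have "between r x y \<subseteq> between r x z"
      unfolding between_def using that(1,2) lin_trans[OF assms] by blast
    then show ?thesis
      using that unfolding S by (meson FieldI1 finite_subset image_mono)
  qed
  ultimately show ?case
    unfolding condensation_def equiv_def by (auto simp del: rho_nat.simps) (auto simp: S intro: FieldI1)
qed

lemma rho_Suc:
  assumes "Linear_order r"
  shows "(x, y) \<in> rho_nat r (Suc n) \<longleftrightarrow> x \<in> Field r \<and> y \<in> Field r \<and>
    finite ((\<lambda>z. rho_nat r n `` {z}) ` between r x y)"
  by (rule rho_Suc_aux[OF assms rho_cond[OF assms]])

declare rho_nat.simps [simp del]

lemma rho_0: "(x, y) \<in> rho_nat r 0 \<longleftrightarrow> x \<in> Field r \<and> x = y"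
  by (auto simp: rho_nat.simps)

lemma rho_class_eq:
  assumes "Linear_order r" "x \<in> Field r"
  shows "rho_nat r n `` {x} = rho_nat r n `` {y} \<longleftrightarrow> (x, y) \<in> rho_nat r n"
  by (rule cond_class_eq[OF rho_cond[OF assms(1)] assms(2)])

lemma rho_between:
  assumes "Linear_order r" "(x, y) \<in> rho_nat r n" "z \<in> between r x y"
  shows "(x, z) \<in> rho_nat r n"
proof -
  note c = rho_cond[OF assms(1), of n]
  consider "(x, z) \<in> r" "(z, y) \<in> r" | "(y, z) \<in> r" "(z, x) \<in> r"
    using assms(3) by (auto simp: between_def)
  then show ?thesis
  proof cases
    case 1
    then show ?thesis by (rule cond_conv[OF c _ _ assms(2)])
  next
    case 2
    then show ?thesis by (rule cond_sym[OF c cond_conv'[OF c _ _ cond_sym[OF c assms(2)]]])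
  qed
qed

lemma rho_mono_Suc:
  assumes "Linear_order r" "(x, y) \<in> rho_nat r n"
  shows "(x, y) \<in> rho_nat r (Suc n)"
proof -
  have "(\<lambda>z. rho_nat r n `` {z}) ` between r x y \<subseteq> {rho_nat r n `` {x}}"
    using rho_between[OF assms] rho_class_eq[OF assms(1)]
      conjunct1[OF cond_Field[OF rho_cond[OF assms(1)] assms(2)]] by blast
  then show ?thesis
    unfolding rho_Suc[OF assms(1)] using cond_Field[OF rho_cond[OF assms(1)] assms(2)]
    by (meson finite.simps finite_subset)
qed

lemma rho_mono:
  assumes "Linear_order r" "(x, y) \<in> rho_nat r m" "m \<le> n"
  shows "(x, y) \<in> rho_nat r n"
  using assms(3,2) by (induction n rule: dec_induct) (auto intro: rho_mono_Suc[OF assms(1)])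

text \<open>An order embedding with convex image.\<close>

definition convex_emb :: "'a rel \<Rightarrow> 'b rel \<Rightarrow> ('a \<Rightarrow> 'b) \<Rightarrow> bool" where
  "convex_emb r r' f \<longleftrightarrow> f ` Field r \<subseteq> Field r' \<and>
     (\<forall>x\<in>Field r. \<forall>y\<in>Field r. (x, y) \<in> r \<longleftrightarrow> (f x, f y) \<in> r') \<and>
     (\<forall>x\<in>Field r. \<forall>y\<in>Field r. \<forall>w. (f x, w) \<in> r' \<longrightarrow> (w, f y) \<in> r' \<longrightarrow> w \<in> f ` Field r)"

text \<open>Whether two points are related by \<open>\<rho>\<^sub>n\<close> depends only on the interval between them.\<close>

lemma rho_convex_emb:
  assumes "Linear_order r" "Linear_order r'" "convex_emb r r' f"
  shows "x \<in> Field r \<Longrightarrow> y \<in> Field r \<Longrightarrow> (f x, f y) \<in> rho_nat r' n \<longleftrightarrow> (x, y) \<in> rho_nat r n"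
proof (induction n arbitrary: x y)
  case 0
  then show ?case
    using assms unfolding convex_emb_def rho_0
    by (metis image_subset_iff lin_antisym lin_refl)
next
  case (Suc n)
  have b: "between r' (f x) (f y) = f ` between r x y"
  proof (intro set_eqI iffI)
    fix w assume "w \<in> between r' (f x) (f y)"
    moreover from this obtain z where "z \<in> Field r" "w = f z"
      using assms(3) Suc.prems unfolding convex_emb_def between_def by blast
    ultimately show "w \<in> f ` between r x y"
      using assms(3) Suc.prems unfolding convex_emb_def between_def by blast
  next
    fix w assume "w \<in> f ` between r x y"
    then obtain z where "z \<in> between r x y" "w = f z" by blast
    then show "w \<in> between r' (f x) (f y)"
      using assms(3) Suc.prems between_Field[of z r x y] unfolding convex_emb_def between_def by blast
  qed
  have "finite ((\<lambda>z. rho_nat r' n `` {f z}) ` between r x y) \<longleftrightarrow>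
      finite ((\<lambda>z. rho_nat r n `` {z}) ` between r x y)"
  proof (rule finite_image_cong)
    fix z w assume "z \<in> between r x y" "w \<in> between r x y"
    then have "z \<in> Field r" "w \<in> Field r" by (auto dest: between_Field)
    moreover from this have "f z \<in> Field r'" using assms(3) by (auto simp: convex_emb_def)
    ultimately show "rho_nat r' n `` {f z} = rho_nat r' n `` {f w} \<longleftrightarrow>
      rho_nat r n `` {z} = rho_nat r n `` {w}"
      using assms Suc.IH by (simp add: rho_class_eq)
  qed
  then show ?case
    using Suc.prems assms(3) unfolding rho_Suc[OF assms(1)] rho_Suc[OF assms(2)] b
    by (auto simp: image_image convex_emb_def)
qed

lemma rho_iso:
  assumes "iso r r' f" "Linear_order r" "Linear_order r'" "x \<in> Field r" "y \<in> Field r"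
  shows "(f x, f y) \<in> rho_nat r' n \<longleftrightarrow> (x, y) \<in> rho_nat r n"
proof (rule rho_convex_emb[OF assms(2,3) _ assms(4,5)])
  show "convex_emb r r' f"
    unfolding convex_emb_def bij_betw_imp_surj_on[OF iso_bij[OF assms(1)]]
    by (auto simp: iso_le[OF assms(1)] intro: FieldI1)
qed

lemma rho_Restr:
  assumes "Linear_order r" "C \<subseteq> Field r"
    and "\<And>x y z. x \<in> C \<Longrightarrow> z \<in> C \<Longrightarrow> (x, y) \<in> r \<Longrightarrow> (y, z) \<in> r \<Longrightarrow> y \<in> C"
  shows "rho_nat (Restr r C) n = rho_nat r n \<inter> C \<times> C"
proof -
  have F: "Field (Restr r C) = C" using assms(2) Field_Restr[OF assms(1)] by auto
  have "convex_emb (Restr r C) r id"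
    unfolding convex_emb_def F using assms(2) by (auto intro: assms(3))
  from rho_convex_emb[OF lin_Restr[OF assms(1)] assms(1) this]
  have "(x, y) \<in> rho_nat (Restr r C) n \<longleftrightarrow> (x, y) \<in> rho_nat r n" if "x \<in> C" "y \<in> C" for x y
    using that unfolding F by auto
  then show ?thesis
    using cond_Field[OF rho_cond[OF lin_Restr[OF assms(1), of C], of n]] unfolding F by auto
qed

text \<open>The case of a component, as used below: it is convex, and it is a union of components of
  lower level.\<close>

lemma rho_class_Field: "Linear_order r \<Longrightarrow> rho_nat r n `` {x} \<subseteq> Field r"
  using cond_Field[OF rho_cond] by fastforce

lemma rho_class_convex:
  assumes "Linear_order r" "y \<in> rho_nat r n `` {x}" "w \<in> rho_nat r n `` {x}" "(y, z) \<in> r" "(z, w) \<in> r"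
  shows "z \<in> rho_nat r n `` {x}"
  using assms rho_cond[OF assms(1), of n] by (meson Image_singleton_iff cond_conv cond_sym cond_trans)

lemma rho_Restr_class:
  assumes "Linear_order r"
  shows "rho_nat (Restr r (rho_nat r m `` {x})) n = rho_nat r n \<inter> (rho_nat r m `` {x}) \<times> (rho_nat r m `` {x})"
  by (rule rho_Restr[OF assms rho_class_Field[OF assms]]) (rule rho_class_convex[OF assms])

lemma rho_subclass:
  assumes "Linear_order r" "n \<le> m" "y \<in> rho_nat r m `` {x}"
  shows "rho_nat r n `` {y} \<subseteq> rho_nat r m `` {x}"
  using assms rho_mono[OF assms(1) _ assms(2)] cond_trans[OF rho_cond[OF assms(1)]] by blast

lemma rho_Restr_class_class:
  assumes "Linear_order r" "n \<le> m" "y \<in> rho_nat r m `` {x}"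
  shows "rho_nat (Restr r (rho_nat r m `` {x})) n `` {y} = rho_nat r n `` {y}"
  using rho_subclass[OF assms] assms(3) by (auto simp: rho_Restr_class[OF assms(1)])

section \<open>Gradings by integers\<close>

text \<open>A monotone map to \<open>\<int>\<close> whose fibres are the classes of the condensation \<open>E\<close>.\<close>

definition grading :: "'a rel \<Rightarrow> 'a rel \<Rightarrow> ('a \<Rightarrow> int) \<Rightarrow> bool" where
  "grading r E h \<longleftrightarrow> (\<forall>x\<in>Field r. \<forall>y\<in>Field r. (x, y) \<in> r \<longrightarrow> h x \<le> h y) \<and>
     (\<forall>x\<in>Field r. \<forall>y\<in>Field r. (x, y) \<in> E \<longleftrightarrow> h x = h y)"

abbreviation fibre :: "'a rel \<Rightarrow> ('a \<Rightarrow> int) \<Rightarrow> int \<Rightarrow> 'a set" where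
  "fibre r h k \<equiv> {x \<in> Field r. h x = k}"

lemma grading_mono: "grading r E h \<Longrightarrow> (x, y) \<in> r \<Longrightarrow> h x \<le> h y"
  by (auto simp: grading_def intro: FieldI1 FieldI2)

lemma grading_iff: "grading r E h \<Longrightarrow> x \<in> Field r \<Longrightarrow> y \<in> Field r \<Longrightarrow> (x, y) \<in> E \<longleftrightarrow> h x = h y"
  by (auto simp: grading_def)

lemma grading_less:
  assumes "Linear_order r" "grading r E h" "x \<in> Field r" "y \<in> Field r" "h x < h y"
  shows "(x, y) \<in> r"
  using assms lin_total grading_mono by (metis linorder_not_le)

lemma grading_class:
  assumes "condensation r E" "grading r E h" "x \<in> Field r"
  shows "E `` {x} = fibre r h (h x)"
  using assms grading_iff[OF assms(2,3)] cond_Field[OF assms(1)] by force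

text \<open>Chains with the same set of indices and isomorphic fibres are isomorphic, and the isomorphisms
  of the fibres can be prescribed.\<close>

lemma glue:
  assumes r: "Linear_order r" "grading r E h" and r': "Linear_order r'" "grading r' E' h'"
    and im: "h ` Field r = h' ` Field r'"
    and g: "\<And>k. k \<in> h ` Field r \<Longrightarrow> iso (Restr r (fibre r h k)) (Restr r' (fibre r' h' k)) (g k)"
  shows "iso r r' (\<lambda>x. g (h x) x)" "x \<in> Field r \<Longrightarrow> h' (g (h x) x) = h x"
proof -
  let ?f = "\<lambda>x. g (h x) x"
  have F: "Field (Restr r (fibre r h k)) = fibre r h k" "Field (Restr r' (fibre r' h' k)) = fibre r' h' k" for k
    using Field_Restr[OF r(1)] Field_Restr[OF r'(1)] by auto
  have in': "?f x \<in> Field r'" "h' (?f x) = h x" if "x \<in> Field r" for x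
    using iso_in[OF g[of "h x"], of x] that unfolding F by auto
  then show "x \<in> Field r \<Longrightarrow> h' (?f x) = h x" by blast
  have le: "(?f x, ?f y) \<in> r' \<longleftrightarrow> (x, y) \<in> r" if xy: "x \<in> Field r" "y \<in> Field r" for x y
  proof (cases "h x" "h y" rule: linorder_cases)
    case equal
    then show ?thesis
      using iso_le[OF g[of "h x"], of x y] xy in'[OF xy(1)] in'[OF xy(2)] unfolding F by auto
  next
    case less
    then show ?thesis
      using grading_less[OF r] grading_less[OF r'] in' xy by metis
  next
    case greater
    then show ?thesis
      using grading_mono[OF r(2), of x y] grading_mono[OF r'(2), of "?f x" "?f y"] in' xy
      by (metis linorder_not_le)
  qed
  show "iso r r' ?f"
  proof (rule isoI)
    have "inj_on ?f (Field r)"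
    proof (rule inj_onI)
      fix x y assume *: "x \<in> Field r" "y \<in> Field r" "?f x = ?f y"
      then have "(x, y) \<in> r" "(y, x) \<in> r"
        using le[of x y] le[of y x] lin_refl[OF r'(1)] in' by auto
      then show "x = y" by (rule lin_antisym[OF r(1)])
    qed
    moreover have "z \<in> ?f ` Field r" if "z \<in> Field r'" for z
    proof -
      have k: "h' z \<in> h ` Field r" using that im by auto
      have "z \<in> fibre r' h' (h' z)" using that by blast
      from iso_surj[OF g[OF k]] this obtain x where "x \<in> fibre r h (h' z)" "z = g (h' z) x"
        unfolding F by metis
      then show ?thesis by (intro image_eqI[of _ _ x]) auto
    qed
    ultimately show "bij_betw ?f (Field r) (Field r')"
      using in' by (auto simp: bij_betw_def)
  qed (use le in auto)
qed

lemma glue_iso: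
  assumes r: "Linear_order r" "grading r E h" and r': "Linear_order r'" "grading r' E' h'"
    and im: "h ` Field r = h' ` Field r'"
    and g: "\<And>k. k \<in> h ` Field r \<Longrightarrow> Restr r (fibre r h k) \<simeq> Restr r' (fibre r' h' k)"
  shows "r \<simeq> r'"
proof -
  have "\<forall>k\<in>h ` Field r. \<exists>f. iso (Restr r (fibre r h k)) (Restr r' (fibre r' h' k)) f"
    using g unfolding chain_iso_def by blast
  from bchoice[OF this] obtain G where
    "\<And>k. k \<in> h ` Field r \<Longrightarrow> iso (Restr r (fibre r h k)) (Restr r' (fibre r' h' k)) (G k)"
    by blast
  from glue(1)[OF r r' im this] show ?thesis unfolding chain_iso_def by blast
qed

lemma grading_quot:
  assumes r: "Linear_order r" "condensation r E" and h: "grading r E h"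
  shows "\<exists>H. iso (quot r E) {(i, j). i \<in> h ` Field r \<and> j \<in> h ` Field r \<and> i \<le> j} H \<and>
    (\<forall>x\<in>Field r. H (E `` {x}) = h x)"
proof (intro exI conjI)
  define H where "H X = h (SOME x. x \<in> X)" for X
  have H: "H (E `` {x}) = h x" if "x \<in> Field r" for x
  proof -
    have "x \<in> E `` {x}" using cond_refl[OF r(2) that] by blast
    then have "(SOME z. z \<in> E `` {x}) \<in> E `` {x}" by (rule someI)
    then show ?thesis using grading_class[OF r(2) h that] by (auto simp: H_def)
  qed
  then show "\<forall>x\<in>Field r. H (E `` {x}) = h x" by blast
  let ?I = "{(i, j). i \<in> h ` Field r \<and> j \<in> h ` Field r \<and> i \<le> j}"
  have FI: "Field ?I = h ` Field r" by (auto simp: Field_def)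
  have FQ: "Field (quot r E) = (\<lambda>x. E `` {x}) ` Field r"
    using quot_FieldI[OF r] by (auto elim!: quot_FieldE)
  have eq: "E `` {x} = E `` {y} \<longleftrightarrow> h x = h y" if "x \<in> Field r" "y \<in> Field r" for x y
    using cond_class_eq[OF r(2)] grading_iff[OF h] that by auto
  show "iso (quot r E) ?I H"
  proof (rule isoI)
    show "bij_betw H (Field (quot r E)) (Field ?I)"
      unfolding FI FQ bij_betw_def inj_on_def by (auto simp: H eq image_image)
    fix X Y assume "X \<in> Field (quot r E)" "Y \<in> Field (quot r E)"
    then obtain x y where "x \<in> Field r" "X = E `` {x}" "y \<in> Field r" "Y = E `` {y}"
      unfolding FQ by blast
    moreover from this have "(x, y) \<in> r \<or> (x, y) \<in> E \<longleftrightarrow> h x \<le> h y"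
      using grading_less[OF r(1) h, of x y] grading_mono[OF h, of x y] grading_iff[OF h, of x y] by force
    ultimately show "(X, Y) \<in> quot r E \<longleftrightarrow> (H X, H Y) \<in> ?I"
      using quot_iff[OF r] by (auto simp: H)
  qed
qed

lemma Field_int_chain: "Field int_chain = UNIV"
  by (auto simp: int_chain_def Field_def)

lemma int_not_nat: "\<not> int_chain \<simeq> natLeq"
proof
  assume "int_chain \<simeq> natLeq"
  then obtain f where f: "iso int_chain natLeq f" by (auto simp: chain_iso_def)
  obtain a where a: "f a = 0" using iso_surj[OF f, of 0] by (auto simp: Field_natLeq)
  have "(a - 1, a) \<in> int_chain" by (simp add: int_chain_def)
  then have "(f (a - 1), f a) \<in> natLeq"
    using iso_le[OF f, of "a - 1" a] by (simp add: Field_int_chain)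
  then have "f (a - 1) = f a" by (simp add: a natLeq_def)
  then show False using iso_eq[OF f] by (simp add: Field_int_chain)
qed

lemma grading_int:
  assumes "Linear_order r" "condensation r E" "grading r E h" "h ` Field r = UNIV"
  shows "quot r E \<simeq> int_chain" "\<not> quot r E \<simeq> natLeq"
proof -
  show "quot r E \<simeq> int_chain"
    using grading_quot[OF assms(1-3)] unfolding chain_iso_def assms(4) int_chain_def by auto
  then show "\<not> quot r E \<simeq> natLeq"
    using int_not_nat chain_iso_trans chain_iso_sym by metis
qed

lemma grading_nat:
  assumes r: "Linear_order r" "condensation r E" "grading r E h" and im: "h ` Field r = {0..}"
  shows "quot r E \<simeq> natLeq"
    and "x \<in> Field r \<Longrightarrow> finite (underS (quot r E) (E `` {x}))"
    and "x \<in> Field r \<Longrightarrow> card (underS (quot r E) (E `` {x})) = nat (h x)"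
proof -
  let ?I = "{(i, j). i \<in> h ` Field r \<and> j \<in> h ` Field r \<and> i \<le> j}"
  have FI: "Field ?I = {0..}" unfolding im by (auto simp: Field_def)
  obtain H where H: "iso (quot r E) ?I H" "\<And>x. x \<in> Field r \<Longrightarrow> H (E `` {x}) = h x"
    using grading_quot[OF r] by blast
  have "iso ?I natLeq nat"
  proof (rule isoI)
    show "bij_betw nat (Field ?I) (Field natLeq)"
      unfolding FI Field_natLeq by (rule bij_betw_byWitness[of _ int]) auto
  qed (unfold FI, auto simp: natLeq_def im)
  then show "quot r E \<simeq> natLeq" using iso_comp[OF H(1)] unfolding chain_iso_def by blast
  assume x: "x \<in> Field r"
  let ?U = "underS (quot r E) (E `` {x})"
  have sub: "?U \<subseteq> Field (quot r E)" by (auto simp: underS_def intro: FieldI1)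
  have xF: "E `` {x} \<in> Field (quot r E)" using quot_FieldI[OF r(1,2) x] .
  have inj: "inj_on H ?U"
    using sub iso_bij[OF H(1)] by (auto simp: bij_betw_def intro: inj_on_subset)
  have im': "H ` ?U = {0..<h x}"
  proof (intro set_eqI iffI)
    fix i assume "i \<in> H ` ?U"
    then obtain X where X: "X \<in> ?U" "i = H X" by blast
    then have "(i, h x) \<in> ?I" "i \<noteq> h x"
      using iso_le[OF H(1), of X "E `` {x}"] iso_eq[OF H(1), of X "E `` {x}"] xF sub x H(2)
      by (auto simp: underS_def)
    then show "i \<in> {0..<h x}" by (auto simp: im)
  next
    fix i assume i: "i \<in> {0..<h x}"
    then have "i \<in> Field ?I" unfolding FI by auto
    then obtain X where X: "X \<in> Field (quot r E)" "i = H X" using iso_surj[OF H(1)] by blast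
    have "(i, h x) \<in> ?I" using i im x by auto
    then have "(X, E `` {x}) \<in> quot r E" using iso_le[OF H(1) X(1) xF] X H(2) x by auto
    moreover have "X \<noteq> E `` {x}" using X H(2)[OF x] i by auto
    ultimately show "i \<in> H ` ?U" using X by (auto simp: underS_def)
  qed
  then have "finite (H ` ?U)" by simp
  then show "finite ?U" using inj finite_imageD by blast
  show "card ?U = nat (h x)" using card_image[OF inj] im' by simp
qed

text \<open>A locally finite chain without greatest element is a copy of \<open>\<nat>\<close> or \<open>\<int>\<close>: the index of a point is
  its signed distance from a base point \<open>z\<close>, which is the least element if there is one.\<close>

lemma locally_finite_index:
  assumes q: "Linear_order q" and ne: "Field q \<noteq> {}"
    and fin: "\<And>x y. x \<in> Field q \<Longrightarrow> y \<in> Field q \<Longrightarrow> finite (between q x y)"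
    and nomax: "\<And>x. x \<in> Field q \<Longrightarrow> \<exists>y. (x, y) \<in> q \<and> x \<noteq> y"
  shows "\<exists>h :: 'a \<Rightarrow> int. inj_on h (Field q) \<and> (\<forall>x\<in>Field q. \<forall>y\<in>Field q. (x, y) \<in> q \<longrightarrow> h x \<le> h y) \<and>
    (h ` Field q = UNIV \<or> h ` Field q = {0..})"
proof -
  obtain z where z: "z \<in> Field q" and
    z_least: "(\<exists>z\<in>Field q. \<forall>x\<in>Field q. (z, x) \<in> q) \<Longrightarrow> \<forall>x\<in>Field q. (z, x) \<in> q"
    using ne by blast
  define I where "I a b = {x. (a, x) \<in> q \<and> (x, b) \<in> q \<and> x \<noteq> b}" for a b
  define h where "h x = (if (z, x) \<in> q then int (card (I z x)) else - int (card (I x z)))" for x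
  note refl = lin_refl[OF q] and trans = lin_trans[OF q] and anti = lin_antisym[OF q]
    and neg = lin_not[OF q]
  have finI: "finite (I a b)" if "a \<in> Field q" "b \<in> Field q" for a b
    using fin[OF that] by (rule finite_subset[rotated]) (auto simp: I_def between_def)
  have Icard: "card (I a b) < card (I a c)"
    if "(a, b) \<in> q" "(b, c) \<in> q" "b \<noteq> c" for a b c
  proof (rule psubset_card_mono)
    show "finite (I a c)" using that by (auto intro!: finI intro: FieldI1 FieldI2)
    have "b \<in> I a c" "b \<notin> I a b" using that by (auto simp: I_def)
    moreover have "I a b \<subseteq> I a c" using that trans anti unfolding I_def by blast
    ultimately show "I a b \<subset> I a c" by blast
  qed
  have Icard': "card (I b c) < card (I a c)"
    if "(a, b) \<in> q" "(b, c) \<in> q" "a \<noteq> b" for a b c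
  proof (rule psubset_card_mono)
    show "finite (I a c)" using that by (auto intro!: finI intro: FieldI1 FieldI2)
    have "(a, a) \<in> q" using that refl by (auto intro: FieldI1)
    then have "a \<in> I a c" "a \<notin> I b c" using that trans anti unfolding I_def by blast+
    moreover have "I b c \<subseteq> I a c" using that trans unfolding I_def by blast
    ultimately show "I b c \<subset> I a c" by blast
  qed
  \<comment> \<open>Next elements have consecutive indices.\<close>
  have cover: "h y = h x + 1"
    if xy: "(x, y) \<in> q" "x \<noteq> y" and c: "\<And>w. (x, w) \<in> q \<Longrightarrow> (w, y) \<in> q \<Longrightarrow> w = x \<or> w = y" for x y
  proof -
    have F: "x \<in> Field q" "y \<in> Field q" using xy by (auto intro: FieldI1 FieldI2)
    show ?thesis
    proof (cases "(z, x) \<in> q")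
      case True
      have *: "w = x" if "(z, w) \<in> q" "(w, y) \<in> q" "w \<noteq> y" "\<not> (w, x) \<in> q" for w
        using that c neg F by (metis FieldI1)
      have "I z y = insert x (I z x)"
      proof (intro set_eqI iffI)
        fix w assume "w \<in> I z y"
        then show "w \<in> insert x (I z x)" using * unfolding I_def by blast
      next
        fix w assume "w \<in> insert x (I z x)"
        then show "w \<in> I z y" using True xy trans anti unfolding I_def by blast
      qed
      moreover have "x \<notin> I z x" by (auto simp: I_def)
      moreover have "(z, y) \<in> q" using True xy trans by blast
      ultimately show ?thesis using True finI[OF z F(1)] by (simp add: h_def)
    next
      case False
      then have xz: "(x, z) \<in> q" "x \<noteq> z" using neg z F refl by auto
      have yz: "(y, z) \<in> q" using c[OF xz(1)] neg[OF F(2) z] xz(2) refl[OF F(2)] by (cases "(y, z) \<in> q") auto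
      have *: "(y, w) \<in> q" if "(x, w) \<in> q" "w \<noteq> x" for w
        using that c neg F by (metis FieldI2 refl)
      have "I x z = insert x (I y z)"
      proof (intro set_eqI iffI)
        fix w assume "w \<in> I x z"
        then show "w \<in> insert x (I y z)" using * unfolding I_def by blast
      next
        fix w assume "w \<in> insert x (I y z)"
        then show "w \<in> I x z" using xz xy trans refl[OF F(1)] unfolding I_def by blast
      qed
      moreover have "x \<notin> I y z" using xy anti by (auto simp: I_def)
      ultimately have "card (I x z) = Suc (card (I y z))" using finI[OF F(2) z] by simp
      moreover have "card (I z y) = 0 \<and> card (I y z) = 0" if "(z, y) \<in> q"
      proof -
        have "z = y" using anti that yz by blast
        then have "I z y = {}" "I y z = {}" using anti by (auto simp: I_def)
        then show ?thesis by simp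
      qed
      ultimately show ?thesis using False by (auto simp: h_def)
    qed
  qed
  have strict: "h x < h y" if xy: "(x, y) \<in> q" "x \<noteq> y" for x y
  proof -
    have F: "x \<in> Field q" "y \<in> Field q" using xy by (auto intro: FieldI1 FieldI2)
    consider "(z, x) \<in> q" "(z, y) \<in> q" | "(z, x) \<notin> q" "(z, y) \<in> q" | "(z, x) \<notin> q" "(z, y) \<notin> q"
      using xy trans by blast
    then show ?thesis
    proof cases
      case 1
      then show ?thesis using Icard[of z x y] xy by (simp add: h_def)
    next
      case 2
      then have "(x, z) \<in> q" "x \<noteq> z" using neg z F refl by auto
      then have "x \<in> I x z" using refl F by (auto simp: I_def)
      then have "card (I x z) > 0" using finI[OF F(1) z] card_gt_0_iff by blast
      then show ?thesis using 2 by (simp add: h_def)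
    next
      case 3
      then have "(y, z) \<in> q" using neg z F by auto
      then show ?thesis using 3 Icard'[of x y z] xy by (simp add: h_def)
    qed
  qed
  have up: "\<exists>y\<in>Field q. h y = h x + 1" if x: "x \<in> Field q" for x
  proof -
    obtain y where y: "(x, y) \<in> q \<and> x \<noteq> y"
      and min: "\<And>w. (x, w) \<in> q \<and> x \<noteq> w \<Longrightarrow> card (I x y) \<le> card (I x w)"
      using ex_has_least_nat[of "\<lambda>y. (x, y) \<in> q \<and> x \<noteq> y" _ "\<lambda>y. card (I x y)"] nomax[OF x] by blast
    have "h y = h x + 1"
    proof (rule cover)
      fix w assume "(x, w) \<in> q" "(w, y) \<in> q"
      then show "w = x \<or> w = y" using min[of w] Icard[of x w y] by force
    qed (use y in auto)
    then show ?thesis using y by (auto intro: FieldI2)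
  qed
  have down: "\<exists>y\<in>Field q. h y = h x - 1" if ex: "\<exists>y. (y, x) \<in> q \<and> y \<noteq> x" for x
  proof -
    obtain y where y: "(y, x) \<in> q \<and> y \<noteq> x"
      and min: "\<And>w. (w, x) \<in> q \<and> w \<noteq> x \<Longrightarrow> card (I y x) \<le> card (I w x)"
      using ex_has_least_nat[of "\<lambda>y. (y, x) \<in> q \<and> y \<noteq> x" _ "\<lambda>y. card (I y x)"] ex by blast
    have "h x = h y + 1"
    proof (rule cover)
      fix w assume "(y, w) \<in> q" "(w, x) \<in> q"
      then show "w = y \<or> w = x" using min[of w] Icard'[of y w x] by force
    qed (use y in auto)
    then show ?thesis using y by (auto intro: FieldI1)
  qed
  have h0: "h z = 0"
  proof -
    have "I z z = {}" using anti by (auto simp: I_def)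
    then show ?thesis by (simp add: h_def)
  qed
  have pos: "\<exists>x\<in>Field q. h x = int n" for n
    by (induction n) (use h0 z up in \<open>force+\<close>)
  have inj: "inj_on h (Field q)"
    by (rule inj_onI) (metis lin_total[OF q] strict less_irrefl)
  have mono: "\<forall>x\<in>Field q. \<forall>y\<in>Field q. (x, y) \<in> q \<longrightarrow> h x \<le> h y"
    using strict by (metis order_le_less)
  have "h ` Field q = UNIV \<or> h ` Field q = {0..}"
  proof (cases "\<exists>z\<in>Field q. \<forall>x\<in>Field q. (z, x) \<in> q")
    case True
    then have "\<forall>x\<in>Field q. 0 \<le> h x" using z_least mono h0 z by metis
    moreover have "i \<in> h ` Field q" if "0 \<le> i" for i
      using pos[of "nat i"] that by force
    ultimately show ?thesis by auto
  next
    case False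
    then have "\<exists>y. (y, x) \<in> q \<and> y \<noteq> x" if "x \<in> Field q" for x
      using that lin_total[OF q] refl by metis
    note down' = down[OF this]
    have "\<exists>x\<in>Field q. h x = - int n" for n
    proof (induction n)
      case (Suc n)
      then show ?case using down' by force
    qed (use h0 z in auto)
    then have "i \<in> h ` Field q" for i
      using pos[of "nat i"] by (cases "0 \<le> i") (force, metis image_eqI nat_0_le neg_0_le_iff_le
        linorder_le_cases minus_minus)
    then show ?thesis by auto
  qed
  then show ?thesis using inj mono by blast
qed

lemma ex_grading:
  assumes r: "Linear_order r" "condensation r E" and ne: "Field r \<noteq> {}"
    and fin: "\<And>x y. x \<in> Field r \<Longrightarrow> y \<in> Field r \<Longrightarrow> finite ((\<lambda>z. E `` {z}) ` between r x y)"
    and nomax: "\<And>x. x \<in> Field r \<Longrightarrow> \<exists>y. (x, y) \<in> r \<and> (x, y) \<notin> E"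
  shows "\<exists>h. grading r E h \<and> (h ` Field r = UNIV \<or> h ` Field r = {0..})"
proof -
  let ?q = "quot r E"
  have FQ: "Field ?q = (\<lambda>x. E `` {x}) ` Field r"
    using quot_FieldI[OF r] by (auto elim!: quot_FieldE)
  have "\<exists>h :: 'a set \<Rightarrow> int. inj_on h (Field ?q) \<and> (\<forall>x\<in>Field ?q. \<forall>y\<in>Field ?q. (x, y) \<in> ?q \<longrightarrow> h x \<le> h y) \<and>
    (h ` Field ?q = UNIV \<or> h ` Field ?q = {0..})"
  proof (rule locally_finite_index)
    show "Linear_order ?q" by (rule quot_linear[OF r])
    show "Field ?q \<noteq> {}" using ne FQ by auto
    fix X assume "X \<in> Field ?q"
    then obtain x where x: "x \<in> Field r" "X = E `` {x}" unfolding FQ by blast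
    obtain y where y: "(x, y) \<in> r" "(x, y) \<notin> E" using nomax[OF x(1)] by blast
    then have "y \<in> Field r" by (auto intro: FieldI2)
    then have "(X, E `` {y}) \<in> ?q \<and> X \<noteq> E `` {y}"
      using quot_iff[OF r x(1)] cond_class_eq[OF r(2) x(1)] y x by auto
    then show "\<exists>Y. (X, Y) \<in> ?q \<and> X \<noteq> Y" by blast
    fix Y assume "Y \<in> Field ?q"
    then obtain y where "y \<in> Field r" "Y = E `` {y}" unfolding FQ by blast
    then show "finite (between ?q X Y)"
      using between_quot[OF r] fin x by simp
  qed
  then obtain h :: "'a set \<Rightarrow> int" where h: "inj_on h (Field ?q)"
    "\<forall>x\<in>Field ?q. \<forall>y\<in>Field ?q. (x, y) \<in> ?q \<longrightarrow> h x \<le> h y" "h ` Field ?q = UNIV \<or> h ` Field ?q = {0..}"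
    by blast
  have "grading r E (\<lambda>x. h (E `` {x}))"
    unfolding grading_def
  proof (intro conjI ballI impI)
    fix x y assume *: "x \<in> Field r" "y \<in> Field r"
    then show "(x, y) \<in> E \<longleftrightarrow> h (E `` {x}) = h (E `` {y})"
      using inj_on_eq_iff[OF h(1)] cond_class_eq[OF r(2), of x y] quot_FieldI[OF r] by simp
    assume "(x, y) \<in> r"
    then show "h (E `` {x}) \<le> h (E `` {y})"
      using h(2) quot_iff[OF r *] quot_FieldI[OF r] * by blast
  qed
  moreover have "(\<lambda>x. h (E `` {x})) ` Field r = h ` Field ?q" unfolding FQ by auto
  ultimately show ?thesis using h(3) by metis
qed

section \<open>Chains consisting of a single \<open>n\<close>-component\<close>

text \<open>A chain consisting of a single \<open>n\<close>-component, in which there is no last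
  \<open>(n - 1)\<close>-component.\<close>

definition ranked :: "nat \<Rightarrow> 'a rel \<Rightarrow> bool" where
  "ranked n r \<longleftrightarrow> Linear_order r \<and> Field r \<noteq> {} \<and>
     (\<forall>x\<in>Field r. \<forall>y\<in>Field r. (x, y) \<in> rho_nat r n) \<and>
     (\<forall>m. n = Suc m \<longrightarrow> (\<forall>x\<in>Field r. \<exists>y. (x, y) \<in> r \<and> (x, y) \<notin> rho_nat r m))"

lemma ranked_iso:
  assumes f: "iso r r' f" and r: "ranked n r" and r': "Linear_order r'"
  shows "ranked n r'"
  unfolding ranked_def
proof (intro conjI ballI allI impI)
  have lr: "Linear_order r" using r by (simp add: ranked_def)
  show "Linear_order r'" by fact
  show "Field r' \<noteq> {}" using r iso_in[OF f] by (auto simp: ranked_def)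
  fix x' assume "x' \<in> Field r'"
  then obtain x where x: "x \<in> Field r" "x' = f x" using iso_surj[OF f] by blast
  show "(x', y') \<in> rho_nat r' n" if "y' \<in> Field r'" for y'
    using iso_surj[OF f that] x r rho_iso[OF f lr r'] by (auto simp: ranked_def)
  fix m assume "n = Suc m"
  then obtain y where y: "(x, y) \<in> r" "(x, y) \<notin> rho_nat r m"
    using r x(1) unfolding ranked_def by blast
  then have "y \<in> Field r" by (auto intro: FieldI2)
  then show "\<exists>y'. (x', y') \<in> r' \<and> (x', y') \<notin> rho_nat r' m"
    using x y rho_iso[OF f lr r'] iso_le[OF f] by metis
qed

text \<open>If a chain is split into convex pieces of this kind, then these are its \<open>n\<close>-components, because
  the part of a piece above a given point meets infinitely many \<open>(n - 1)\<close>-components.\<close>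

lemma ranked_pieces:
  assumes r: "Linear_order r" and mono: "\<And>x y. (x, y) \<in> r \<Longrightarrow> h x \<le> h y"
    and rk: "\<And>k. k \<in> h ` Field r \<Longrightarrow> ranked n (Restr r (fibre r h k))"
  shows "grading r (rho_nat r n) h"
proof -
  have R: "rho_nat (Restr r (fibre r h k)) m = rho_nat r m \<inter> fibre r h k \<times> fibre r h k" for k m
  proof (rule rho_Restr[OF r])
    fix x y z assume "x \<in> fibre r h k" "z \<in> fibre r h k" "(x, y) \<in> r" "(y, z) \<in> r"
    then show "y \<in> fibre r h k" using mono[of x y] mono[of y z] by (auto intro: FieldI2)
  qed auto
  have F: "Field (Restr r (fibre r h k)) = fibre r h k" for k
    using Field_Restr[OF r] by auto
  have same: "(x, y) \<in> rho_nat r n" if "x \<in> Field r" "y \<in> Field r" "h x = h y" for x y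
    using rk[of "h x"] that unfolding ranked_def F R by auto
  have diff: "(x, y) \<notin> rho_nat r n" if xy: "x \<in> Field r" "y \<in> Field r" "h x < h y" for x y
  proof (cases n)
    case 0
    then show ?thesis using that by (auto simp: rho_0)
  next
    case (Suc m)
    have "(x, y) \<in> r" using xy lin_total[OF r] mono by (metis linorder_not_le)
    let ?c = "\<lambda>z. rho_nat r m `` {z}"
    let ?S = "{z \<in> fibre r h (h x). (x, z) \<in> r}"
    have "infinite (?c ` ?S)"
    proof
      assume fin: "finite (?c ` ?S)"
      \<comment> \<open>From any point of the piece above \<open>x\<close> one can go to a new class, with fewer classes above it.\<close>
      let ?T = "\<lambda>z. {w \<in> fibre r h (h x). (z, w) \<in> r}"
      obtain z where z: "z \<in> ?S" and min: "\<And>w. w \<in> ?S \<Longrightarrow> card (?c ` ?T z) \<le> card (?c ` ?T w)"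
        using ex_has_least_nat[of "\<lambda>z. z \<in> ?S" x "\<lambda>z. card (?c ` ?T z)"] xy lin_refl[OF r] by auto
      obtain w where w: "w \<in> fibre r h (h x)" "(z, w) \<in> r" "(z, w) \<notin> rho_nat r m"
        using rk[of "h x"] xy z Suc unfolding ranked_def F R by auto
      have "w \<in> ?S" using w z lin_trans[OF r] by blast
      have less: "?c ` ?T w \<subset> ?c ` ?T z"
      proof
        show "?c ` ?T w \<subseteq> ?c ` ?T z" using w lin_trans[OF r] by blast
        have "z \<in> ?T z" using z lin_refl[OF r] by auto
        moreover have "?c z \<noteq> ?c v" if "v \<in> ?T w" for v
        proof
          assume "?c z = ?c v"
          then have "(z, v) \<in> rho_nat r m" using rho_class_eq[OF r] z by blast
          then show False using w that cond_conv[OF rho_cond[OF r]] by blast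
        qed
        ultimately show "?c ` ?T w \<noteq> ?c ` ?T z" by blast
      qed
      have "finite (?c ` ?T z)"
        by (rule finite_subset[OF _ fin]) (use z lin_trans[OF r, of x z] in blast)
      then show False using psubset_card_mono[OF _ less] min[OF \<open>w \<in> ?S\<close>] by simp
    qed
    moreover have "?S \<subseteq> between r x y"
    proof
      fix z assume z: "z \<in> ?S"
      then have "(z, y) \<in> r" using xy lin_total[OF r, of z y] mono[of y z] by force
      then show "z \<in> between r x y" using z by (auto simp: between_def)
    qed
    ultimately have "infinite (?c ` between r x y)"
      by (meson image_mono finite_subset)
    then show ?thesis by (simp add: Suc rho_Suc[OF r])
  qed
  show ?thesis
    unfolding grading_def using same diff mono cond_sym[OF rho_cond[OF r]]
    by (metis linorder_neqE)
qed

lemma ranked_Suc: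
  assumes r: "Linear_order r" and ne: "Field r \<noteq> {}" and h: "grading r (rho_nat r n) h"
    and up: "\<And>x. x \<in> Field r \<Longrightarrow> \<exists>y\<in>Field r. h x < h y"
  shows "ranked (Suc n) r"
  unfolding ranked_def
proof (intro conjI ballI allI impI)
  fix x y assume xy: "x \<in> Field r" "y \<in> Field r"
  have "finite (h ` between r x y)"
  proof (rule finite_subset)
    show "h ` between r x y \<subseteq> {min (h x) (h y)..max (h x) (h y)}"
      by (auto simp: between_def dest!: grading_mono[OF h])
  qed simp
  moreover have "finite (h ` between r x y) \<longleftrightarrow> finite ((\<lambda>z. rho_nat r n `` {z}) ` between r x y)"
    by (rule finite_image_cong) (simp add: rho_class_eq[OF r] grading_iff[OF h] between_Field)
  ultimately show "(x, y) \<in> rho_nat r (Suc n)" using xy by (simp add: rho_Suc[OF r])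
next
  fix x m assume "x \<in> Field r" "Suc n = Suc m"
  then show "\<exists>y. (x, y) \<in> r \<and> (x, y) \<notin> rho_nat r m"
    using up grading_less[OF r h] grading_iff[OF h] by (metis less_irrefl old.nat.inject)
qed (use r ne in auto)

section \<open>The chains \<open>\<A>(s)\<close>\<close>

text \<open>A sequence is full if its last entry \<open>s(n)\<close> has the greatest possible value \<open>n\<close>.

  Both cases of the recursion for \<open>\<A>(s)\<close> are treated as a sum over an index set \<open>idx s\<close>, which
  is \<open>\<int>\<close> or \<open>\<nat>\<close>; the summand of index \<open>k\<close> is \<open>\<A>(sub s k)\<close>, and \<open>pt s a k\<close> is its point \<open>a\<close>.\<close>

definition full :: "nat list \<Rightarrow> bool" where
  "full s \<longleftrightarrow> last s = length s - 1"

definition idx :: "nat list \<Rightarrow> int set" where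
  "idx s = (if full s then UNIV else {0..})"

definition sub :: "nat list \<Rightarrow> int \<Rightarrow> nat list" where
  "sub s k = (if full s \<or> k \<noteq> 0 then sminus s else splus s)"

definition pt :: "nat list \<Rightarrow> point \<Rightarrow> int \<Rightarrow> point" where
  "pt s a k = (if full s then InZ a k else if k = 0 then InL a else InR a (nat (k - 1)))"

text \<open>The index of the summand that contains a given point; the value at \<open>Origin\<close> is irrelevant.\<close>

fun pidx :: "point \<Rightarrow> int" where
  "pidx Origin = 0"
| "pidx (InZ a k) = k"
| "pidx (InL a) = 0"
| "pidx (InR a k) = int k + 1"

lemma pidx_pt: "k \<in> idx s \<Longrightarrow> pidx (pt s a k) = k"
  by (auto simp: pt_def idx_def split: if_splits)

lemma pt_inj: "pt s a k = pt s b k \<longleftrightarrow> a = b"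
  by (auto simp: pt_def)

lemma length_sub: "2 \<le> length s \<Longrightarrow> length (sub s k) = length s - 1"
  by (auto simp: sub_def sminus_def splus_def)

lemma zero_in_idx: "0 \<in> idx s"
  by (simp add: idx_def)

lemma idx_up: "k \<in> idx s \<Longrightarrow> k + 1 \<in> idx s"
  by (simp add: idx_def split: if_splits)

lemma fin_chain_short: "length s \<le> 1 \<Longrightarrow> fin_chain s = {(Origin, Origin)}"
  by (simp add: fin_chain.simps)

lemma Field_chain_times_nat: "Field (chain_times A natLeq) = Field A \<times> UNIV"
proof -
  have *: "((a, k), (a, Suc k)) \<in> chain_times A natLeq" if "a \<in> Field A" for a k
    using that by (auto simp: chain_times_def natLeq_def)
  have "Field A \<times> UNIV \<subseteq> Field (chain_times A natLeq)"
    using FieldI1[OF *] by auto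
  moreover have "Field (chain_times A natLeq) \<subseteq> Field A \<times> UNIV"
    unfolding Field_def[of "chain_times A natLeq"] unfolding chain_times_def by blast
  ultimately show ?thesis by blast
qed

lemma fin_chain_full:
  assumes "2 \<le> length s" "full s"
  shows "fin_chain s = {(InZ a k, InZ b l) | a k b l. a \<in> Field (fin_chain (sminus s)) \<and>
    b \<in> Field (fin_chain (sminus s)) \<and> k \<le> l \<and> (k = l \<longrightarrow> (a, b) \<in> fin_chain (sminus s))}"
proof -
  have "fin_chain s = dir_image (chain_times (fin_chain (sminus s)) int_chain) (\<lambda>(a, k). InZ a k)"
    using assms by (subst fin_chain.simps) (simp add: full_def)
  then show ?thesis
    unfolding dir_image_def chain_times_def int_chain_def by fastforce
qed

lemma fin_chain_not_full:
  assumes "2 \<le> length s" "\<not> full s"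
  shows "fin_chain s = {(InL a, InL b) | a b. (a, b) \<in> fin_chain (splus s)} \<union>
    {(InL a, InR b k) | a b k. a \<in> Field (fin_chain (splus s)) \<and> b \<in> Field (fin_chain (sminus s))} \<union>
    {(InR a k, InR b l) | a k b l. a \<in> Field (fin_chain (sminus s)) \<and>
    b \<in> Field (fin_chain (sminus s)) \<and> k \<le> l \<and> (k = l \<longrightarrow> (a, b) \<in> fin_chain (sminus s))}"
proof -
  define A B where "A = fin_chain (splus s)" and "B = fin_chain (sminus s)"
  have "fin_chain s = dir_image (chain_plus (fin_chain (splus s)) (chain_times (fin_chain (sminus s)) natLeq))
             (case_sum InL (\<lambda>(a, k). InR a k))"
    using assms by (subst fin_chain.simps) (simp add: full_def)
  also have "\<dots> = {(InL a, InL b) | a b. (a, b) \<in> A} \<union>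
    {(InL a, InR b k) | a b k. a \<in> Field A \<and> b \<in> Field B} \<union>
    {(InR a k, InR b l) | a k b l. a \<in> Field B \<and> b \<in> Field B \<and> k \<le> l \<and> (k = l \<longrightarrow> (a, b) \<in> B)}"
    (is "dir_image ?r ?f = ?R")
  proof (intro set_eqI iffI)
    fix e assume "e \<in> dir_image ?r ?f"
    then show "e \<in> ?R"
      unfolding dir_image_def chain_plus_def A_def[symmetric] B_def[symmetric] Field_chain_times_nat
      by (auto simp: chain_times_def natLeq_def)
  next
    have d: "(f x, f y) \<in> dir_image r f" if "(x, y) \<in> r" for r x y and f :: "'u \<Rightarrow> 'v"
      using that by (auto simp: dir_image_def)
    have "(InL a, InL b) \<in> dir_image ?r ?f" if "(a, b) \<in> A" for a b
      using d[of "Inl a" "Inl b" ?r ?f] that by (simp add: chain_plus_def A_def)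
    moreover have "(InL a, InR b k) \<in> dir_image ?r ?f" if "a \<in> Field A" "b \<in> Field B" for a b k
      using d[of "Inl a" "Inr (b, k)" ?r ?f] that
      by (simp add: chain_plus_def A_def B_def Field_chain_times_nat)
    moreover have "(InR a k, InR b l) \<in> dir_image ?r ?f"
      if "a \<in> Field B \<and> b \<in> Field B \<and> k \<le> l \<and> (k = l \<longrightarrow> (a, b) \<in> B)" for a b k l
      using d[of "Inr (a, k)" "Inr (b, l)" ?r ?f] that
      by (simp add: chain_plus_def chain_times_def B_def natLeq_def)
    moreover fix e assume "e \<in> ?R"
    ultimately show "e \<in> dir_image ?r ?f" by blast
  qed
  finally show ?thesis unfolding A_def B_def .
qed

lemma fin_chain_le:
  assumes "2 \<le> length s" "k \<in> idx s" "l \<in> idx s"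
  shows "(pt s a k, pt s b l) \<in> fin_chain s \<longleftrightarrow> a \<in> Field (fin_chain (sub s k)) \<and>
    b \<in> Field (fin_chain (sub s l)) \<and> (k < l \<or> k = l \<and> (a, b) \<in> fin_chain (sub s k))"
proof (cases "full s")
  case True
  then show ?thesis
    unfolding fin_chain_full[OF assms(1) True] by (auto simp: pt_def sub_def)
next
  case False
  then show ?thesis
    using assms(2,3) unfolding fin_chain_not_full[OF assms(1) False]
    by (auto simp: pt_def sub_def idx_def intro: FieldI1 FieldI2)
qed

lemma fin_chain_pt:
  assumes "2 \<le> length s" "(p, q) \<in> fin_chain s"
  shows "\<exists>a b. p = pt s a (pidx p) \<and> q = pt s b (pidx q) \<and> pidx p \<in> idx s \<and> pidx q \<in> idx s"
proof (cases "full s")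
  case True
  then show ?thesis
    using assms(2) unfolding fin_chain_full[OF assms(1) True] by (auto simp: pt_def idx_def)
next
  case False
  then show ?thesis
    using assms(2) unfolding fin_chain_not_full[OF assms(1) False] by (auto simp: pt_def idx_def)
qed

lemma Field_fin_chainE:
  assumes "2 \<le> length s" "p \<in> Field (fin_chain s)"
  obtains a where "p = pt s a (pidx p)" "pidx p \<in> idx s" "a \<in> Field (fin_chain (sub s (pidx p)))"
proof -
  obtain q where "(p, q) \<in> fin_chain s \<or> (q, p) \<in> fin_chain s"
    using assms(2) by (auto simp: Field_def)
  then obtain a b where ab: "p = pt s a (pidx p)" "q = pt s b (pidx q)" "pidx p \<in> idx s" "pidx q \<in> idx s"
    "(pt s a (pidx p), pt s b (pidx q)) \<in> fin_chain s \<or> (pt s b (pidx q), pt s a (pidx p)) \<in> fin_chain s"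
    using fin_chain_pt[OF assms(1)] by metis
  then have "a \<in> Field (fin_chain (sub s (pidx p)))"
    using fin_chain_le[OF assms(1)] by blast
  then show thesis using that ab by blast
qed

lemma fin_chain_linear: "Linear_order (fin_chain s)"
proof (induction "length s" arbitrary: s rule: less_induct)
  case less
  show ?case
  proof (cases "2 \<le> length s")
    case False
    then show ?thesis
      by (intro linI) (auto simp: fin_chain_short Field_def)
  next
    case True
    have IH: "Linear_order (fin_chain (sub s k))" for k
      using less[of "sub s k"] length_sub[OF True] True by auto
    note le = fin_chain_le[OF True]
    show ?thesis
    proof (rule linI)
      fix p assume "p \<in> Field (fin_chain s)"
      then obtain a where a: "p = pt s a (pidx p)" "pidx p \<in> idx s" "a \<in> Field (fin_chain (sub s (pidx p)))"
        using Field_fin_chainE[OF True] by metis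
      then show "(p, p) \<in> fin_chain s"
        using le[OF a(2,2), of a a] lin_refl[OF IH] by metis
      fix q assume "q \<in> Field (fin_chain s)"
      then obtain b where b: "q = pt s b (pidx q)" "pidx q \<in> idx s" "b \<in> Field (fin_chain (sub s (pidx q)))"
        using Field_fin_chainE[OF True] by metis
      show "(p, q) \<in> fin_chain s \<or> (q, p) \<in> fin_chain s"
        using le[OF a(2) b(2), of a b] le[OF b(2) a(2), of b a] a b lin_total[OF IH]
        by (metis linorder_neqE)
    next
      fix p q w assume *: "(p, q) \<in> fin_chain s" "(q, w) \<in> fin_chain s"
      obtain a b c where p: "p = pt s a (pidx p)" "q = pt s b (pidx q)" "w = pt s c (pidx w)"
        and i: "pidx p \<in> idx s" "pidx q \<in> idx s" "pidx w \<in> idx s"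
        using fin_chain_pt[OF True *(1)] fin_chain_pt[OF True *(2)] pt_inj by metis
      then show "(p, w) \<in> fin_chain s"
        using * le[OF i(1,2), of a b] le[OF i(2,3), of b c] le[OF i(1,3), of a c] lin_trans[OF IH]
        by (smt (verit))
    next
      fix p q assume *: "(p, q) \<in> fin_chain s" "(q, p) \<in> fin_chain s"
      obtain a b where p: "p = pt s a (pidx p)" "q = pt s b (pidx q)"
        and i: "pidx p \<in> idx s" "pidx q \<in> idx s"
        using fin_chain_pt[OF True *(1)] by metis
      then show "p = q"
        using * le[OF i(1,2), of a b] le[OF i(2,1), of b a] lin_antisym[OF IH]
        by (smt (verit))
    qed
  qed
qed

lemma Field_fin_chain_pt:
  assumes "2 \<le> length s" "k \<in> idx s"
  shows "pt s a k \<in> Field (fin_chain s) \<longleftrightarrow> a \<in> Field (fin_chain (sub s k))"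
  using fin_chain_le[OF assms(1,2,2), of a a] lin_refl[OF fin_chain_linear]
  by (metis FieldI1)

lemma pidx_in_idx: "2 \<le> length s \<Longrightarrow> p \<in> Field (fin_chain s) \<Longrightarrow> pidx p \<in> idx s"
  by (elim Field_fin_chainE)

lemma pidx_mono: "2 \<le> length s \<Longrightarrow> (p, q) \<in> fin_chain s \<Longrightarrow> pidx p \<le> pidx q"
  using fin_chain_pt fin_chain_le by (metis order.order_iff_strict)

lemma fin_chain_fibre:
  assumes "2 \<le> length s" "k \<in> idx s"
  shows "fibre (fin_chain s) pidx k = (\<lambda>a. pt s a k) ` Field (fin_chain (sub s k))"
proof (intro set_eqI iffI)
  fix p assume "p \<in> fibre (fin_chain s) pidx k"
  then show "p \<in> (\<lambda>a. pt s a k) ` Field (fin_chain (sub s k))"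
    using Field_fin_chainE[OF assms(1)] by blast
qed (use pidx_pt[OF assms(2)] Field_fin_chain_pt[OF assms] in auto)

lemma fin_chain_fibre_iso:
  assumes "2 \<le> length s" "k \<in> idx s"
  shows "iso (fin_chain (sub s k)) (Restr (fin_chain s) (fibre (fin_chain s) pidx k)) (\<lambda>a. pt s a k)"
proof (rule isoI)
  have F: "Field (Restr (fin_chain s) (fibre (fin_chain s) pidx k)) = fibre (fin_chain s) pidx k"
    using Field_Restr[OF fin_chain_linear] by auto
  show "bij_betw (\<lambda>a. pt s a k) (Field (fin_chain (sub s k)))
     (Field (Restr (fin_chain s) (fibre (fin_chain s) pidx k)))"
    unfolding F unfolding fin_chain_fibre[OF assms] by (auto simp: bij_betw_def inj_on_def pt_inj)
  fix a b assume "a \<in> Field (fin_chain (sub s k))" "b \<in> Field (fin_chain (sub s k))"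
  then show "(a, b) \<in> fin_chain (sub s k) \<longleftrightarrow>
    (pt s a k, pt s b k) \<in> Restr (fin_chain s) (fibre (fin_chain s) pidx k)"
    using fin_chain_le[OF assms assms(2), of a b] Field_fin_chain_pt[OF assms] pidx_pt[OF assms(2)] by auto
qed

text \<open>The chain \<open>\<A>(s)\<close> of a sequence of length \<open>n + 1\<close> has rank \<open>n\<close>; for \<open>n > 0\<close> its \<open>(n - 1)\<close>-components are
  the summands by which it is defined. Both are shown in one induction. Only the length of \<open>s\<close> matters
  here.\<close>

lemma fin_chain_ranked_grading:
  "length s = Suc n \<Longrightarrow> ranked n (fin_chain s)"
  "length s = Suc (Suc n) \<Longrightarrow> grading (fin_chain s) (rho_nat (fin_chain s) n) pidx"
  "length s = Suc (Suc n) \<Longrightarrow> pidx ` Field (fin_chain s) = idx s"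
proof -
  have ne: "Field (fin_chain s) \<noteq> {}" for s
  proof (induction "length s" arbitrary: s rule: less_induct)
    case less
    show ?case
    proof (cases "2 \<le> length s")
      case True
      then show ?thesis
        using less[of "sub s 0"] length_sub[OF True] Field_fin_chain_pt[OF True zero_in_idx] True
        by (metis One_nat_def diff_less ex_in_conv less_le_trans pos2 zero_less_one)
    qed (simp add: fin_chain_short)
  qed
  have im: "pidx ` Field (fin_chain s) = idx s" if "2 \<le> length s" for s
  proof (intro equalityI subsetI)
    fix k assume k: "k \<in> idx s"
    obtain a where "a \<in> Field (fin_chain (sub s k))" using ne by blast
    then have "pt s a k \<in> Field (fin_chain s)" using Field_fin_chain_pt[OF that k] by blast
    then show "k \<in> pidx ` Field (fin_chain s)" using pidx_pt[OF k] by (metis imageI)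
  qed (use pidx_in_idx[OF that] in blast)
  have gr: "grading (fin_chain s) (rho_nat (fin_chain s) n) pidx"
    if "length s = Suc (Suc n)" and IH: "\<And>s. length s = Suc n \<Longrightarrow> ranked n (fin_chain s)" for n s
  proof -
    from that(1) have l: "2 \<le> length s" by simp
    show ?thesis
    proof (rule ranked_pieces[OF fin_chain_linear pidx_mono[OF l]])
      fix k assume "k \<in> pidx ` Field (fin_chain s)"
      then have "k \<in> idx s" using im[OF l] by simp
      then show "ranked n (Restr (fin_chain s) (fibre (fin_chain s) pidx k))"
        by (rule ranked_iso[OF fin_chain_fibre_iso[OF l] IH lin_Restr[OF fin_chain_linear]])
          (use length_sub[OF l] that(1) in simp)
    qed
  qed
  have rk: "ranked n (fin_chain s)" if "length s = Suc n" for n s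
    using that
  proof (induction n arbitrary: s)
    case 0
    then show ?case using fin_chain_linear[of s]
      by (auto simp: ranked_def fin_chain_short rho_0)
  next
    case (Suc n)
    then have l: "2 \<le> length s" by simp
    show ?case
    proof (rule ranked_Suc[OF fin_chain_linear ne gr[OF Suc.prems Suc.IH]])
      fix p assume "p \<in> Field (fin_chain s)"
      then have "pidx p + 1 \<in> idx s" using pidx_in_idx[OF l] idx_up by blast
      then have "pidx p + 1 \<in> pidx ` Field (fin_chain s)" using im[OF l] by simp
      then show "\<exists>q\<in>Field (fin_chain s). pidx p < pidx q" by force
    qed
  qed
  show "length s = Suc n \<Longrightarrow> ranked n (fin_chain s)" by (rule rk)
  show "length s = Suc (Suc n) \<Longrightarrow> grading (fin_chain s) (rho_nat (fin_chain s) n) pidx"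
    using gr rk by blast
  show "length s = Suc (Suc n) \<Longrightarrow> pidx ` Field (fin_chain s) = idx s"
    using im by simp
qed

lemma fin_chain_iso_grading:
  assumes D: "Linear_order D" "D \<simeq> fin_chain s" and l: "length s = Suc (Suc n)"
  shows "\<exists>h. grading D (rho_nat D n) h \<and> h ` Field D = idx s \<and>
    (\<forall>k\<in>idx s. Restr D (fibre D h k) \<simeq> fin_chain (sub s k))"
proof -
  note gr = fin_chain_ranked_grading(2,3)[OF l]
  have l2: "2 \<le> length s" using l by simp
  obtain f where f: "iso D (fin_chain s) f" using D(2) by (auto simp: chain_iso_def)
  let ?h = "pidx \<circ> f"
  have "grading D (rho_nat D n) ?h"
    unfolding grading_def
    using grading_mono[OF gr(1)] grading_iff[OF gr(1)] iso_le[OF f] iso_in[OF f]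
      rho_iso[OF f D(1) fin_chain_linear]
    by (metis comp_apply)
  moreover have "?h ` Field D = idx s"
    using gr(2) iso_bij[OF f] by (metis bij_betw_imp_surj_on image_comp)
  moreover have "Restr D (fibre D ?h k) \<simeq> fin_chain (sub s k)" if k: "k \<in> idx s" for k
  proof -
  have "f ` fibre D ?h k = fibre (fin_chain s) pidx k"
    using iso_in[OF f] iso_surj[OF f] by force
  then have "iso (Restr D (fibre D ?h k)) (Restr (fin_chain s) (fibre (fin_chain s) pidx k)) f"
    by (intro iso_Restr[OF f D(1) fin_chain_linear]) auto
  then show ?thesis
    by (rule chain_iso_trans[OF chain_isoI chain_iso_sym[OF chain_isoI[OF fin_chain_fibre_iso[OF l2 k]]]])
  qed
  ultimately show ?thesis by blast
qed

lemma fin_chain_isoI: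
  assumes D: "Linear_order D" "grading D E h" and l: "length s = Suc (Suc n)"
    and im: "h ` Field D = idx s" and fib: "\<And>k. k \<in> idx s \<Longrightarrow> Restr D (fibre D h k) \<simeq> fin_chain (sub s k)"
  shows "D \<simeq> fin_chain s"
proof (rule glue_iso[OF D fin_chain_linear fin_chain_ranked_grading(2)[OF l]])
  show "h ` Field D = pidx ` Field (fin_chain s)" using im fin_chain_ranked_grading(3)[OF l] by simp
  fix k assume "k \<in> h ` Field D"
  then have "k \<in> idx s" "2 \<le> length s" using im l by auto
  then show "Restr D (fibre D h k) \<simeq> Restr (fin_chain s) (fibre (fin_chain s) pidx k)"
    using chain_iso_trans[OF fib chain_isoI[OF fin_chain_fibre_iso]] by blast
qed

text \<open>The \<open>E\<close>-class of \<open>x\<close> is not the first one.\<close>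

definition nonfirst :: "'a rel \<Rightarrow> 'a rel \<Rightarrow> 'a \<Rightarrow> bool" where
  "nonfirst r E x \<longleftrightarrow> (\<exists>y. (y, x) \<in> r \<and> (y, x) \<notin> E)"

lemma nonfirst_iff:
  assumes D: "Linear_order D" "grading D E h" and im: "h ` Field D = idx s" and x: "x \<in> Field D"
  shows "nonfirst D E x \<longleftrightarrow> full s \<or> h x \<noteq> 0"
proof
  assume "nonfirst D E x"
  then obtain y where y: "(y, x) \<in> D" "(y, x) \<notin> E" by (auto simp: nonfirst_def)
  then have "y \<in> Field D" by (auto intro: FieldI1)
  then have "h y < h x" "h y \<in> idx s"
    using y grading_iff[OF D(2)] grading_mono[OF D(2)] x im by force+
  then show "full s \<or> h x \<noteq> 0" by (auto simp: idx_def split: if_splits)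
next
  assume *: "full s \<or> h x \<noteq> 0"
  moreover have "h x \<in> idx s" using im x by blast
  ultimately have "h x - 1 \<in> idx s" by (auto simp: idx_def split: if_splits)
  then obtain y where "y \<in> Field D" "h y = h x - 1" using im by force
  then show "nonfirst D E x"
    unfolding nonfirst_def using grading_less[OF D, of y x] grading_iff[OF D(2), of y x] x by auto
qed

text \<open>The type \<open>s\<close> of a chain determines the types \<open>s\<^sup>-\<close> and \<open>s\<^sup>+\<close> of its components. The statement does
  not mention indices, so that two representations of one chain can be compared.\<close>

lemma component_type:
  assumes D: "Linear_order D" "D \<simeq> fin_chain s" and l: "length s = Suc (Suc n)"
  shows "x \<in> Field D \<Longrightarrow> Restr D (rho_nat D n `` {x}) \<simeq>
      fin_chain (if nonfirst D (rho_nat D n) x then sminus s else splus s)"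
    and "full s \<longleftrightarrow> (\<forall>x\<in>Field D. nonfirst D (rho_nat D n) x)"
    and "\<exists>x\<in>Field D. nonfirst D (rho_nat D n) x"
proof -
  obtain h where h: "grading D (rho_nat D n) h" "h ` Field D = idx s"
    and fib: "\<And>k. k \<in> idx s \<Longrightarrow> Restr D (fibre D h k) \<simeq> fin_chain (sub s k)"
    using fin_chain_iso_grading[OF assms] by blast
  note nf = nonfirst_iff[OF D(1) h]
  show "Restr D (rho_nat D n `` {x}) \<simeq>
      fin_chain (if nonfirst D (rho_nat D n) x then sminus s else splus s)" if "x \<in> Field D"
  proof -
    have "h x \<in> idx s" using h(2) that by blast
    then show ?thesis
      using fib[of "h x"] grading_class[OF rho_cond[OF D(1)] h(1) that] nf[OF that]
      by (simp add: sub_def)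
  qed
  have "0 \<in> h ` Field D" "1 \<in> h ` Field D" unfolding h(2) by (auto simp: idx_def)
  then show "full s \<longleftrightarrow> (\<forall>x\<in>Field D. nonfirst D (rho_nat D n) x)" "\<exists>x\<in>Field D. nonfirst D (rho_nat D n) x"
    using nf by force+
qed

lemma sminus_seqs: "u \<in> seqs (Suc n) \<Longrightarrow> sminus u \<in> seqs n"
  by (auto simp: seqs_def sminus_def nth_butlast)

lemma splus_seqs:
  assumes "u \<in> seqs (Suc (Suc n))" "\<not> full u"
  shows "splus u \<in> seqs (Suc n)"
proof -
  have l: "length u = Suc (Suc n)" and le: "\<And>i. i < Suc (Suc n) \<Longrightarrow> u ! i \<le> i"
    using assms(1) by (auto simp: seqs_def)
  have last: "last u = u ! Suc n" using l by (metis diff_Suc_1 last_conv_nth list.size(3) nat.distinct(1))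
  then have "u ! Suc n \<le> n" using le[of "Suc n"] assms(2) l by (auto simp: full_def)
  then have "splus u ! i \<le> i" if "i < Suc n" for i
    using that le[of i] l last by (cases "i = n") (auto simp: splus_def nth_append nth_butlast)
  then show ?thesis using l by (auto simp: seqs_def splus_def)
qed

lemma fin_chain_unique:
  assumes "s \<in> seqs (Suc n)" "t \<in> seqs (Suc n)" "fin_chain s \<simeq> fin_chain t"
  shows "s = t"
  using assms
proof (induction n arbitrary: s t)
  case 0
  then show ?case by (auto simp: seqs_def length_Suc_conv)
next
  case (Suc n)
  let ?D = "fin_chain s" and ?E = "rho_nat (fin_chain s) n"
  have l: "length s = Suc (Suc n)" "length t = Suc (Suc n)" using Suc.prems by (auto simp: seqs_def)
  note S = component_type[OF fin_chain_linear chain_iso_refl l(1)]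
    and T = component_type[OF fin_chain_linear Suc.prems(3) l(2)]
  have eq: "sminus s = butlast s" "sminus t = butlast t" by (simp_all add: sminus_def)
  have bl: "u = butlast u @ [last u]" if "length u = Suc (Suc n)" for u :: "nat list"
    using that by (metis append_butlast_last_id list.size(3) nat.distinct(1))
  obtain x where "x \<in> Field ?D" "nonfirst ?D ?E x" using S(3) by blast
  then have "fin_chain (sminus s) \<simeq> fin_chain (sminus t)"
    using S(1)[of x] T(1)[of x] chain_iso_sym chain_iso_trans by (metis (full_types))
  then have 1: "butlast s = butlast t" using Suc.IH sminus_seqs Suc.prems eq by metis
  show ?case
  proof (cases "full s")
    case True
    then have "full t" using S(2) T(2) by blast
    then show ?thesis using True 1 bl l unfolding full_def by metis
  next
    case False
    then have nt: "\<not> full t" using S(2) T(2) by blast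
    obtain x where "x \<in> Field ?D" "\<not> nonfirst ?D ?E x" using False S(2) by blast
    then have "fin_chain (splus s) \<simeq> fin_chain (splus t)"
      using S(1)[of x] T(1)[of x] chain_iso_sym chain_iso_trans by (metis (full_types))
    then have "splus s = splus t" using Suc.IH splus_seqs False nt Suc.prems by metis
    then show ?thesis using 1 bl l unfolding splus_def by (metis last_snoc)
  qed
qed

section \<open>Components of uniform chains of rank \<open>\<omega>\<close>\<close>

locale uniform_omega =
  fixes r :: "'a rel"
  assumes lin: "Linear_order r" and unif: "uniform_chain r" and rank: "has_rank r \<infinity>"
begin

text \<open>The \<open>n\<close>-component of \<open>x\<close>, as a set and as a chain.\<close>

abbreviation comp :: "nat \<Rightarrow> 'a \<Rightarrow> 'a set" where
  "comp n x \<equiv> rho_nat r n `` {x}"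

abbreviation cchain :: "nat \<Rightarrow> 'a \<Rightarrow> 'a rel" where
  "cchain n x \<equiv> Restr r (comp n x)"

lemmas cond = rho_cond[OF lin] and le_refl = lin_refl[OF lin] and rho_refl = cond_refl[OF rho_cond[OF lin]]

lemma rho_Field: "(x, y) \<in> rho_nat r n \<Longrightarrow> x \<in> Field r \<and> y \<in> Field r"
  using cond_Field[OF cond] .

lemma cchain_linear: "Linear_order (cchain n x)"
  by (rule lin_Restr[OF lin])

lemma Field_cchain: "Field (cchain n x) = comp n x"
  using Field_Restr[OF lin] rho_class_Field[OF lin] by blast

lemma comp_self: "x \<in> Field r \<Longrightarrow> x \<in> comp n x"
  using rho_refl by blast

lemma rho_cchain: "rho_nat (cchain m x) n = rho_nat r n \<inter> comp m x \<times> comp m x"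
  by (rule rho_Restr_class[OF lin])

lemma cchain_class:
  assumes "y \<in> comp (Suc n) x"
  shows "rho_nat (cchain (Suc n) x) n `` {y} = comp n y"
    and "Restr (cchain (Suc n) x) (comp n y) = cchain n y"
proof -
  show "rho_nat (cchain (Suc n) x) n `` {y} = comp n y"
    by (rule rho_Restr_class_class[OF lin _ assms]) simp
  have "comp n y \<subseteq> comp (Suc n) x" by (rule rho_subclass[OF lin _ assms]) simp
  then show "Restr (cchain (Suc n) x) (comp n y) = cchain n y" by blast
qed

text \<open>By uniformity, any point can be moved to any other by an isomorphism of final segments,
  which respects components.\<close>

lemma upset_iso:
  assumes x: "x \<in> Field r" "y \<in> Field r"
  shows "\<exists>f. iso (Restr r (above r x)) (Restr r (above r y)) f \<and> f x = y \<and>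
    (\<forall>a b n. a \<in> above r x \<longrightarrow> b \<in> above r x \<longrightarrow> (f a, f b) \<in> rho_nat r n \<longleftrightarrow> (a, b) \<in> rho_nat r n)"
proof -
  have F: "Field (Restr r (above r z)) = above r z" for z
    using Field_Restr[OF lin] by (auto simp: above_def intro: FieldI2)
  obtain f where f: "iso (Restr r (above r x)) (Restr r (above r y)) f"
    using unif x by (auto simp: uniform_chain_def chain_iso_def)
  have self: "z \<in> above r z" if "z \<in> Field r" for z using le_refl[OF that] by (simp add: above_def)
  have fin: "f a \<in> above r y" if "a \<in> above r x" for a using iso_in[OF f] that unfolding F .
  obtain a where a: "a \<in> above r x" "f a = y" using iso_surj[OF f, of y] self[OF x(2)] unfolding F by auto
  have "(f x, f a) \<in> r"
    using iso_le[OF f, of x a] a self[OF x(1)] unfolding F by (auto simp: above_def)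
  moreover have "(y, f x) \<in> r" using fin[OF self[OF x(1)]] by (simp add: above_def)
  ultimately have fx: "f x = y" using lin_antisym[OF lin] a by metis
  have R: "rho_nat (Restr r (above r z)) n = rho_nat r n \<inter> above r z \<times> above r z" for n z
    by (rule rho_Restr[OF lin]) (auto simp: above_def intro: FieldI2 lin_trans[OF lin])
  have "(f a, f b) \<in> rho_nat r n \<longleftrightarrow> (a, b) \<in> rho_nat r n" if "a \<in> above r x" "b \<in> above r x" for a b n
    using rho_iso[OF f lin_Restr[OF lin] lin_Restr[OF lin], of a b n] that fin
    unfolding F R by auto
  then show ?thesis using f fx by blast
qed

lemma Field_nonempty: "Field r \<noteq> {}"
proof
  assume "Field r = {}"
  then have "quot_chain r \<infinity> = {}" by (auto simp: quot_chain_def quot_def quotient_def)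
  moreover obtain f where f: "iso (quot_chain r \<infinity>) one_chain f"
    using rank by (auto simp: has_rank_def chain_iso_def)
  ultimately show False using iso_surj[OF f, of "()"] by (auto simp: one_chain_def Field_def)
qed

lemma rho_omega_total:
  assumes "x \<in> Field r" "y \<in> Field r"
  shows "\<exists>n. (x, y) \<in> rho_nat r n"
proof -
  let ?E = "\<Union>n. rho_nat r n"
  have self: "z \<in> ?E `` {z}" if "z \<in> Field r" for z using rho_refl that by blast
  have F: "?E `` {z} \<in> Field (quot_chain r \<infinity>)" if "z \<in> Field r" for z
  proof -
    have "(?E `` {z}, ?E `` {z}) \<in> quot_chain r \<infinity>"
      using self[OF that] that le_refl by (auto simp: quot_chain_def quot_def rho_def quotient_def)
    then show ?thesis by (rule FieldI1)
  qed
  obtain f where f: "iso (quot_chain r \<infinity>) one_chain f"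
    using rank by (auto simp: has_rank_def chain_iso_def)
  have "?E `` {x} = ?E `` {y}"
    using iso_eq[OF f F[OF assms(1)] F[OF assms(2)]] by auto
  then show ?thesis using self[OF assms(2)] by auto
qed

text \<open>If one \<open>n\<close>-component had no successor within its \<open>(n + 1)\<close>-component, then by uniformity
  none would have, and the condensation would be stationary from \<open>n\<close> on.\<close>

lemma next_component:
  assumes x: "x \<in> Field r"
  shows "\<exists>y. (x, y) \<in> r \<and> (x, y) \<notin> rho_nat r n \<and> (x, y) \<in> rho_nat r (Suc n)"
proof (rule ccontr)
  assume "\<not> ?thesis"
  then have no: "(x, y) \<in> rho_nat r n" if "(x, y) \<in> r" "(x, y) \<in> rho_nat r (Suc n)" for y
    using that by blast
  have no': "(y, z) \<in> rho_nat r n" if z: "(y, z) \<in> r" "(y, z) \<in> rho_nat r (Suc n)" for y z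
  proof -
    have y: "y \<in> Field r" using z by (auto intro: FieldI1)
    obtain f where f: "f y = x" "iso (Restr r (above r y)) (Restr r (above r x)) f"
      and R: "\<And>a b n. a \<in> above r y \<Longrightarrow> b \<in> above r y \<Longrightarrow> (f a, f b) \<in> rho_nat r n \<longleftrightarrow> (a, b) \<in> rho_nat r n"
      using upset_iso[OF y x] by blast
    have a: "y \<in> above r y" "z \<in> above r y" using z le_refl[OF y] by (auto simp: above_def)
    have "Field (Restr r (above r y)) = above r y"
      using Field_Restr[OF lin] by (auto simp: above_def intro: FieldI2)
    then have "(f y, f z) \<in> r" using iso_le[OF f(2), of y z] a z by auto
    then show ?thesis using no[of "f z"] R[OF a] z f(1) by auto
  qed
  have sub: "(y, z) \<in> rho_nat r n" if z: "(y, z) \<in> rho_nat r (Suc n)" for y z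
    using lin_total[OF lin, of y z] rho_Field[OF z] no'[of y z] no'[of z y] cond_sym[OF cond] z by metis
  have "rho_nat r (Suc n) = rho_nat r n" using sub rho_mono_Suc[OF lin] by auto
  then have stat: "rho_nat r (n + k) = rho_nat r n" for k
    by (induction k) (auto simp: rho_nat.simps(2))
  have "rho r \<infinity> = rho r (enat n)"
    using stat rho_mono[OF lin] by (auto simp: rho_def) (metis le_add1 le_add2 add.commute)
  then have "quot_chain r (enat n) \<simeq> one_chain"
    using rank by (simp add: has_rank_def quot_chain_def)
  then show False using rank by (simp add: has_rank_def)
qed

lemma component_grading:
  assumes x: "x \<in> Field r"
  shows "\<exists>h. grading (cchain (Suc n) x) (rho_nat (cchain (Suc n) x) n) h \<and>
    (h ` comp (Suc n) x = UNIV \<or> h ` comp (Suc n) x = {0..})"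
proof -
  let ?D = "cchain (Suc n) x"
  have "\<exists>h. grading ?D (rho_nat ?D n) h \<and> (h ` Field ?D = UNIV \<or> h ` Field ?D = {0..})"
  proof (rule ex_grading[OF cchain_linear rho_cond[OF cchain_linear]])
    show "Field ?D \<noteq> {}" unfolding Field_cchain using comp_self[OF x] by blast
    fix y assume y: "y \<in> Field ?D"
    have "(y, z) \<in> rho_nat ?D (Suc n)" if "z \<in> Field ?D" for z
      using y that cond_sym[OF cond] cond_trans[OF cond]
      unfolding rho_cchain Field_cchain by blast
    then show "finite ((\<lambda>z. rho_nat ?D n `` {z}) ` between ?D y z)" if "z \<in> Field ?D" for z
      using that rho_Suc[OF cchain_linear] by blast
    have "y \<in> Field r" using y rho_Field unfolding Field_cchain by blast
    then obtain z where z: "(y, z) \<in> r" "(y, z) \<notin> rho_nat r n" "(y, z) \<in> rho_nat r (Suc n)"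
      using next_component by blast
    then have "z \<in> comp (Suc n) x" using y cond_trans[OF cond] unfolding Field_cchain by blast
    then show "\<exists>z. (y, z) \<in> ?D \<and> (y, z) \<notin> rho_nat ?D n"
      using z y unfolding Field_cchain rho_cchain by blast
  qed
  then show ?thesis unfolding Field_cchain .
qed

text \<open>The \<open>n\<close>-component of \<open>x\<close> is not the first one in the \<open>(n + 1)\<close>-component of \<open>x\<close>.\<close>

abbreviation nf :: "nat \<Rightarrow> 'a \<Rightarrow> bool" where
  "nf n x \<equiv> nonfirst (cchain (Suc n) x) (rho_nat (cchain (Suc n) x) n) x"

lemma comp_eq: "y \<in> comp n x \<Longrightarrow> comp n y = comp n x"
  using cond_class_eq[OF cond] rho_Field by blast

lemma nf_iff: "nf n x \<longleftrightarrow> (\<exists>y. (y, x) \<in> r \<and> (y, x) \<notin> rho_nat r n \<and> (y, x) \<in> rho_nat r (Suc n))"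
proof -
  have "x \<in> comp (Suc n) x \<and> y \<in> comp (Suc n) x \<longleftrightarrow> (y, x) \<in> rho_nat r (Suc n)" for y
    using cond_sym[OF cond] comp_self rho_Field by blast
  then show ?thesis unfolding nonfirst_def rho_cchain by blast
qed

lemma nf_exists: "\<exists>y\<in>Field r. nf n y"
  using Field_nonempty next_component unfolding nf_iff by (meson FieldI2 all_not_in_conv)

text \<open>The components that are not first have an immediate predecessor. They are all isomorphic,
  since an isomorphism between final segments maps next components to next components.\<close>

lemma nf_predecessor:
  assumes "nf n y"
  shows "\<exists>x. (x, y) \<in> r \<and> (x, y) \<notin> rho_nat r n \<and>
    (\<forall>w. (x, w) \<in> r \<longrightarrow> (w, y) \<in> r \<longrightarrow> (x, w) \<in> rho_nat r n \<or> (w, y) \<in> rho_nat r n)"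
proof -
  let ?D = "cchain (Suc n) y"
  have y: "y \<in> Field r" using assms unfolding nf_iff by (auto intro: FieldI2)
  obtain h where h: "grading ?D (rho_nat ?D n) h" "h ` Field ?D = UNIV \<or> h ` Field ?D = {0..}"
    using component_grading[OF y] unfolding Field_cchain by blast
  have yD: "y \<in> Field ?D" using comp_self[OF y] Field_cchain by blast
  note E = grading_iff[OF h(1), unfolded rho_cchain Field_cchain]
  obtain z where z: "(z, y) \<in> ?D" "(z, y) \<notin> rho_nat ?D n" using assms by (auto simp: nonfirst_def)
  from z(1) have zD: "z \<in> Field ?D" by (rule FieldI1)
  then have "h z < h y"
    using z grading_mono[OF h(1) z(1)] grading_iff[OF h(1) _ yD] by force
  with zD have "h y - 1 \<in> h ` Field ?D"
    using h(2) imageI[of z "Field ?D" h] by (elim disjE) simp_all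
  then obtain x where x: "h y - 1 = h x" "x \<in> Field ?D" by (rule imageE)
  then have xy: "(x, y) \<in> ?D" using grading_less[OF cchain_linear h(1) _ yD, of x] by simp
  moreover have "(x, y) \<notin> rho_nat r n"
    using x E[of x y] yD unfolding Field_cchain by auto
  moreover have "(x, w) \<in> rho_nat r n \<or> (w, y) \<in> rho_nat r n" if w: "(x, w) \<in> r" "(w, y) \<in> r" for w
  proof -
    have "x \<in> comp (Suc n) y" "y \<in> comp (Suc n) y" using x yD unfolding Field_cchain by auto
    then have c: "w \<in> comp (Suc n) y" using rho_class_convex[OF lin _ _ w] by blast
    then have "(x, w) \<in> ?D" "(w, y) \<in> ?D" using w x yD unfolding Field_cchain by auto
    then have "h x \<le> h w" "h w \<le> h y" using grading_mono[OF h(1)] by auto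
    then have "h w = h x \<or> h w = h y" using x by auto
    then show ?thesis using E c x(2) yD unfolding Field_cchain by auto
  qed
  ultimately show ?thesis by blast
qed

lemma nf_iso:
  assumes "nf n y" "nf n y'"
  shows "cchain n y \<simeq> cchain n y'"
proof -
  obtain x where x: "(x, y) \<in> r" "(x, y) \<notin> rho_nat r n"
    "\<And>w. (x, w) \<in> r \<Longrightarrow> (w, y) \<in> r \<Longrightarrow> (x, w) \<in> rho_nat r n \<or> (w, y) \<in> rho_nat r n"
    using nf_predecessor[OF assms(1)] by blast
  obtain x' where x': "(x', y') \<in> r" "(x', y') \<notin> rho_nat r n"
    "\<And>w. (x', w) \<in> r \<Longrightarrow> (w, y') \<in> r \<Longrightarrow> (x', w) \<in> rho_nat r n \<or> (w, y') \<in> rho_nat r n"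
    using nf_predecessor[OF assms(2)] by blast
  have F: "x \<in> Field r" "x' \<in> Field r" "y \<in> Field r" "y' \<in> Field r"
    using x(1) x'(1) by (auto intro: FieldI1 FieldI2)
  let ?U = "Restr r (above r x)" and ?U' = "Restr r (above r x')"
  have FU: "Field ?U = above r x" "Field ?U' = above r x'"
    using Field_Restr[OF lin] by (auto simp: above_def intro: FieldI2)
  obtain f where f: "iso ?U ?U' f" "f x = x'"
    and R: "\<And>a b n. a \<in> above r x \<Longrightarrow> b \<in> above r x \<Longrightarrow> (f a, f b) \<in> rho_nat r n \<longleftrightarrow> (a, b) \<in> rho_nat r n"
    using upset_iso[OF F(1,2)] by blast
  have up: "x \<in> above r x" "y \<in> above r x" "x' \<in> above r x'" "y' \<in> above r x'"
    using x(1) x'(1) le_refl F by (auto simp: above_def)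
  have le: "(f a, f b) \<in> r \<longleftrightarrow> (a, b) \<in> r" if "a \<in> above r x" "b \<in> above r x" for a b
    using iso_le[OF f(1), of a b] iso_in[OF f(1)] that unfolding FU by auto
  have fin: "f a \<in> above r x'" if "a \<in> above r x" for a using iso_in[OF f(1)] that unfolding FU .
  have fyF: "f y \<in> Field r" using fin[OF up(2)] by (auto simp: above_def intro: FieldI2)
  have x'fy: "(x', f y) \<in> r" "(x', f y) \<notin> rho_nat r n"
    using le[OF up(1,2)] R[OF up(1,2)] f(2) x by auto
  have fy: "(f y, y') \<in> rho_nat r n"
  proof (cases "(f y, y') \<in> r")
    case True
    then show ?thesis using x'(3)[OF x'fy(1)] x'fy(2) by blast
  next
    case False
    then have "(y', f y) \<in> r" using lin_not[OF lin] fyF F by blast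
    obtain w where w: "w \<in> above r x" "y' = f w"
      using iso_surj[OF f(1), of y'] up(4) unfolding FU by auto
    then have "(w, y) \<in> r" using \<open>(y', f y) \<in> r\<close> le[OF w(1) up(2)] by auto
    moreover have "(x, w) \<notin> rho_nat r n" using R[OF up(1) w(1)] x'(2) w(2) f(2) by auto
    ultimately have "(w, y) \<in> rho_nat r n" using x(3) w(1) by (auto simp: above_def)
    then show ?thesis using R[OF w(1) up(2)] w(2) cond_sym[OF cond] by blast
  qed
  have subU: "comp n a \<subseteq> above r b"
    if a: "(b, a) \<in> r" "(b, a) \<notin> rho_nat r n" for a b
  proof
    fix z assume z: "z \<in> comp n a"
    have "b \<in> Field r" using a by (auto intro: FieldI1)
    then show "z \<in> above r b"
      using cond_less[OF lin cond a(1) a(2) rho_refl, of z] z by (auto simp: above_def)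
  qed
  have im: "f ` comp n y = comp n (f y)"
  proof (intro set_eqI iffI)
    fix z assume "z \<in> f ` comp n y"
    then show "z \<in> comp n (f y)" using R subU[OF x(1,2)] up(2) by blast
  next
    fix z assume z: "z \<in> comp n (f y)"
    then obtain w where w: "w \<in> above r x" "z = f w"
      using iso_surj[OF f(1), of z] subU[OF x'fy] unfolding FU by auto
    then show "z \<in> f ` comp n y" using R[OF up(2) w(1)] z by blast
  qed
  have "iso (Restr ?U (comp n y)) (Restr ?U' (f ` comp n y)) f"
    by (rule iso_Restr[OF f(1) lin_Restr[OF lin] lin_Restr[OF lin]])
      (use FU subU[OF x(1,2)] in auto)
  moreover have "Restr ?U (comp n y) = cchain n y" using subU[OF x(1,2)] by blast
  moreover have "Restr ?U' (f ` comp n y) = cchain n y'"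
  proof -
    have "comp n (f y) = comp n y'" using comp_eq fy by (metis Image_singleton_iff)
    then show ?thesis unfolding im using subU[OF x'(1,2)] by blast
  qed
  ultimately show ?thesis using chain_isoI by metis
qed

text \<open>This is the part of Pastijn's theorem that is needed: the components are of the form
  \<open>\<A>(s)\<close>. Those of the same level have the same sequence up to the last entry.\<close>

lemma component_sequence:
  "\<exists>t\<in>seqs n. \<forall>x\<in>Field r. \<exists>a\<le>n. cchain n x \<simeq> fin_chain (t @ [a])"
proof (induction n)
  case 0
  have "cchain 0 x \<simeq> fin_chain [0]" if "x \<in> Field r" for x
  proof -
    have "comp 0 x = {x}" using that by (auto simp: rho_0)
    then have "cchain 0 x = {(x, x)}" using le_refl that by auto
    moreover have "iso {(x, x)} {(Origin, Origin)} (\<lambda>_. Origin)"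
      by (rule isoI) (auto simp: bij_betw_def)
    ultimately show ?thesis by (auto simp: fin_chain_short chain_iso_def)
  qed
  then show ?case by (auto simp: seqs_def)
next
  case (Suc n)
  then obtain t where t: "t \<in> seqs n"
    and ty: "\<And>x. x \<in> Field r \<Longrightarrow> \<exists>a\<le>n. cchain n x \<simeq> fin_chain (t @ [a])" by blast
  obtain y where y: "y \<in> Field r" "nf n y" using nf_exists by blast
  obtain a where a: "a \<le> n" "cchain n y \<simeq> fin_chain (t @ [a])" using ty[OF y(1)] by blast
  define u where "u = t @ [a]"
  have lt: "length t = n" using t by (simp add: seqs_def)
  have u: "u \<in> seqs (Suc n)" using t a by (auto simp: u_def seqs_def nth_append less_Suc_eq)
  have "\<exists>b\<le>Suc n. cchain (Suc n) x \<simeq> fin_chain (u @ [b])" if x: "x \<in> Field r" for x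
  proof -
    let ?D = "cchain (Suc n) x"
    obtain h where h: "grading ?D (rho_nat ?D n) h" "h ` Field ?D = UNIV \<or> h ` Field ?D = {0..}"
      using component_grading[OF x] unfolding Field_cchain by blast
    have fib: "Restr ?D (fibre ?D h (h z)) = cchain n z" if "z \<in> Field ?D" for z
      using that grading_class[OF rho_cond[OF cchain_linear] h(1) that] cchain_class[of z n x]
      unfolding Field_cchain by simp
    have nfz: "cchain n z \<simeq> fin_chain u"
      if z: "z \<in> Field ?D" "nonfirst ?D (rho_nat ?D n) z" for z
    proof -
      have "comp (Suc n) z = comp (Suc n) x" using comp_eq z(1) unfolding Field_cchain by blast
      then have "nf n z" using z(2) by simp
      then show ?thesis unfolding u_def by (rule chain_iso_trans[OF nf_iso[OF _ y(2)] a(2)])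
    qed
    \<comment> \<open>The first component, if there is one, determines the last entry.\<close>
    obtain b where b: "b \<le> Suc n" "h ` Field ?D = idx (u @ [b])"
      and fst: "\<And>z. z \<in> Field ?D \<Longrightarrow> h z = 0 \<Longrightarrow> \<not> full (u @ [b]) \<Longrightarrow> cchain n z \<simeq> fin_chain (t @ [b])"
    proof (cases "h ` Field ?D = UNIV")
      case True
      have "full (u @ [Suc n])" using u by (simp add: full_def seqs_def)
      then show ?thesis using True by (intro that[of "Suc n"]) (simp_all add: idx_def)
    next
      case False
      then have im: "h ` Field ?D = {0..}" using h(2) by blast
      then have "0 \<in> h ` Field ?D" by simp
      then obtain z where z: "0 = h z" "z \<in> Field ?D" by (rule imageE)
      then have "z \<in> Field r" using rho_Field unfolding Field_cchain by blast
      then obtain b where b: "b \<le> n" "cchain n z \<simeq> fin_chain (t @ [b])" using ty by blast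
      have "cchain n w \<simeq> fin_chain (t @ [b])" if "w \<in> Field ?D" "h w = 0" for w
        using fib[OF z(2)] fib[OF that(1)] that(2) z(1) b(2) by simp
      moreover have "\<not> full (u @ [b])" using u b(1) by (simp add: full_def seqs_def)
      ultimately show ?thesis using b(1) im by (intro that[of b]) (simp_all add: idx_def)
    qed
    have "?D \<simeq> fin_chain (u @ [b])"
    proof (rule fin_chain_isoI[OF cchain_linear h(1) _ b(2)])
      show "length (u @ [b]) = Suc (Suc n)" using u by (simp add: seqs_def)
      fix k assume "k \<in> idx (u @ [b])"
      then obtain z where z: "z \<in> Field ?D" "k = h z" using b(2) by blast
      show "Restr ?D (fibre ?D h k) \<simeq> fin_chain (sub (u @ [b]) k)"
      proof (cases "full (u @ [b]) \<or> k \<noteq> 0")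
        case True
        then have "nonfirst ?D (rho_nat ?D n) z"
          using nonfirst_iff[OF cchain_linear h(1) b(2) z(1)] z(2) by blast
        then show ?thesis using True nfz z fib by (simp add: sub_def sminus_def)
      next
        case False
        have "sub (u @ [b]) k = t @ [b]"
          using False by (simp add: sub_def splus_def u_def butlast_append)
        then show ?thesis using fst[OF z(1)] False z(2) fib[OF z(1)] by simp
      qed
    qed
    then show ?thesis using b(1) by blast
  qed
  then show ?case using u by blast
qed

lemma type_seq:
  assumes "x \<in> Field r"
  shows "type_seq r x n \<in> seqs (Suc n)" "cchain n x \<simeq> fin_chain (type_seq r x n)"
proof -
  obtain t a where t: "t \<in> seqs n" "a \<le> n" "cchain n x \<simeq> fin_chain (t @ [a])"
    using component_sequence[of n] assms by blast
  have "t @ [a] \<in> seqs (Suc n)" using t by (auto simp: seqs_def nth_append less_Suc_eq)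
  then have "\<exists>s. s \<in> seqs (Suc n) \<and> Restr r (component r (enat n) x) \<simeq> fin_chain s"
    using t(3) by (auto simp: component_def rho_def)
  from someI_ex[OF this]
  show "type_seq r x n \<in> seqs (Suc n)" "cchain n x \<simeq> fin_chain (type_seq r x n)"
    by (auto simp: type_seq_def component_def rho_def)
qed

lemma type_seq_eq:
  assumes "x \<in> Field r" "s \<in> seqs (Suc n)" "cchain n x \<simeq> fin_chain s"
  shows "type_seq r x n = s"
  using fin_chain_unique[OF type_seq(1)[OF assms(1)] assms(2)] type_seq(2)[OF assms(1)] assms(3)
    chain_iso_sym chain_iso_trans by metis

text \<open>The recursion for \<open>\<A>(s\<^sub>n\<^sub>+\<^sub>1)\<close> read backwards: it links consecutive types to the embedding sequence. The
  last part retains the decomposition of the \<open>(n + 1)\<close>-component, with the index of the summand of \<open>x\<close>.\<close>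

lemma type_seq_step:
  assumes x: "x \<in> Field r"
    and S_def: "S = type_seq r x (Suc n)"
  shows "type_seq r x n = (if nf n x then sminus S else splus S)"
    and "full S \<longleftrightarrow> emb_seq r x n = \<infinity>"
    and "nf n x \<longleftrightarrow> 0 < emb_seq r x n"
    and "\<exists>h. grading (cchain (Suc n) x) (rho_nat (cchain (Suc n) x) n) h \<and> h ` comp (Suc n) x = idx S \<and>
      (\<forall>k\<in>idx S. Restr (cchain (Suc n) x) (fibre (cchain (Suc n) x) h k) \<simeq> fin_chain (sub S k)) \<and>
      (emb_seq r x n \<noteq> \<infinity> \<longrightarrow> emb_seq r x n = enat (nat (h x)))"
proof -
  let ?D = "cchain (Suc n) x"
  have S: "S \<in> seqs (Suc (Suc n))" "?D \<simeq> fin_chain S" using type_seq[OF x] by (simp_all add: S_def)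
  then have l: "length S = Suc (Suc n)" by (simp add: seqs_def)
  note ct = component_type[OF cchain_linear S(2) l, unfolded Field_cchain]
  have "cchain n x \<simeq> fin_chain (if nf n x then sminus S else splus S)"
    using ct(1)[OF comp_self[OF x]] cchain_class[OF comp_self[OF x]] by simp
  moreover have "(if nf n x then sminus S else splus S) \<in> seqs (Suc n)"
    using S(1) ct(2) comp_self[OF x] sminus_seqs splus_seqs by auto
  ultimately show "type_seq r x n = (if nf n x then sminus S else splus S)"
    using type_seq_eq[OF x] by blast
  obtain h where h: "grading ?D (rho_nat ?D n) h" "h ` Field ?D = idx S"
    and fib: "\<And>k. k \<in> idx S \<Longrightarrow> Restr ?D (fibre ?D h k) \<simeq> fin_chain (sub S k)"
    using fin_chain_iso_grading[OF cchain_linear S(2) l] by blast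
  have xD: "x \<in> Field ?D" using comp_self[OF x] Field_cchain by blast
  have Q: "emb_seq r x n = (let Q = quot ?D (rho_nat ?D n) in
      if Q \<simeq> natLeq then enat (card (underS Q (rho_nat ?D n `` {x}))) else \<infinity>)"
    using cchain_class(1)[OF comp_self[OF x]]
    by (simp add: emb_seq_def component_def rho_def quot_chain_def Let_def)
  have \<pi>: "emb_seq r x n = (if full S then \<infinity> else enat (nat (h x)))"
  proof (cases "full S")
    case True
    then show ?thesis
      using grading_int[OF cchain_linear rho_cond[OF cchain_linear] h(1)] h(2) by (simp add: Q idx_def)
  next
    case False
    then have "h ` Field ?D = {0..}" using h(2) by (simp add: idx_def)
    from grading_nat[OF cchain_linear rho_cond[OF cchain_linear] h(1) this]
    show ?thesis using False xD by (simp add: Q)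
  qed
  then show "full S \<longleftrightarrow> emb_seq r x n = \<infinity>" by simp
  have "h x \<in> idx S" using h(2) xD by blast
  then show "nf n x \<longleftrightarrow> 0 < emb_seq r x n"
    using nonfirst_iff[OF cchain_linear h xD] \<pi>
    by (auto simp: idx_def zero_enat_def split: if_splits)
  show "\<exists>h. grading ?D (rho_nat ?D n) h \<and> h ` comp (Suc n) x = idx S \<and>
      (\<forall>k\<in>idx S. Restr ?D (fibre ?D h k) \<simeq> fin_chain (sub S k)) \<and>
      (emb_seq r x n \<noteq> \<infinity> \<longrightarrow> emb_seq r x n = enat (nat (h x)))"
    using h fib \<pi> unfolding Field_cchain by (intro exI[of _ h]) auto
qed

end

section \<open>Derived sequences and embedding systems\<close>

text \<open>A sequence of types \<open>s\<^sub>n\<close> linked by the embedding sequence \<open>\<pi>\<close> as are the types of the components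
  of a point.\<close>

locale linked_sequence =
  fixes s :: "nat \<Rightarrow> nat list" and \<pi> :: "nat \<Rightarrow> enat"
  assumes seqs: "s n \<in> seqs (Suc n)"
    and step: "s n = (if 0 < \<pi> n then sminus (s (Suc n)) else splus (s (Suc n)))"
    and full_iff: "full (s (Suc n)) \<longleftrightarrow> \<pi> n = \<infinity>"
begin

lemma len: "length (s n) = Suc n"
  using seqs[of n] by (simp add: seqs_def)

lemma last_s: "last (s n) = s n ! n"
  using len[of n] by (metis diff_Suc_1 last_conv_nth list.size(3) nat.distinct(1))

lemma nth_sminus: "i \<le> n \<Longrightarrow> sminus (s (Suc n)) ! i = s (Suc n) ! i"
  using len[of "Suc n"] by (simp add: sminus_def nth_butlast)

lemma nth_Suc: "i < n \<Longrightarrow> s (Suc n) ! i = s n ! i"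
  using step[of n] nth_sminus[of i n] len[of "Suc n"]
  by (auto simp: splus_def nth_append nth_butlast split: if_splits)

lemma nth_stable: "i < n \<Longrightarrow> s n ! i = s (Suc i) ! i"
  by (induction n) (auto simp: nth_Suc less_Suc_eq)

lemma last_pos: "0 < \<pi> n \<Longrightarrow> s n ! n = s (Suc n) ! n"
  using step[of n] nth_sminus[of n n] by simp

lemma last_zero: "\<pi> n = 0 \<Longrightarrow> s n ! n = s (Suc n) ! Suc n"
  using step[of n] last_s[of n] last_s[of "Suc n"] by (simp add: splus_def)

lemma last_zeros:
  assumes "m \<le> n" "\<And>v. m \<le> v \<Longrightarrow> v < n \<Longrightarrow> \<pi> v = 0"
  shows "s m ! m = s n ! n"
  using assms by (induction n rule: dec_induct) (auto simp: last_zero)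

text \<open>Here \<open>\<sigma>\<close> is the trunk. The value at \<open>\<infinity>\<close> matters only if \<open>\<pi>\<close> is eventually zero; by \<open>last_zeros\<close> it
  does not depend on the choice of \<open>m\<close> below.\<close>

context
  fixes \<sigma> :: "enat \<Rightarrow> enat"
  assumes \<sigma>_fin: "\<And>k. \<sigma> (enat k) = enat (sminus (s (Suc k)) ! k)"
    and \<sigma>_inf: "\<And>m. (\<forall>n\<ge>m. \<pi> n = 0) \<Longrightarrow> \<sigma> \<infinity> = enat (s m ! m)"
begin

lemma \<sigma>_nth: "i < n \<Longrightarrow> \<sigma> (enat i) = enat (s n ! i)"
  using nth_stable[of i n] nth_sminus[of i i] \<sigma>_fin[of i] by simp

lemma \<sigma>_pos: "0 < \<pi> n \<Longrightarrow> \<sigma> (enat n) = enat (s n ! n)"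
  using last_pos[of n] nth_sminus[of n n] \<sigma>_fin[of n] by simp

lemma \<sigma>_next_pos: "\<sigma> (next_pos \<pi> n) = enat (s n ! n)"
proof (cases "\<exists>v\<ge>n. 0 < \<pi> v")
  case True
  define w where "w = (LEAST v. n \<le> v \<and> 0 < \<pi> v)"
  have w: "n \<le> w" "0 < \<pi> w"
    using LeastI_ex[of "\<lambda>v. n \<le> v \<and> 0 < \<pi> v"] True by (auto simp: w_def)
  have "\<pi> v = 0" if "n \<le> v" "v < w" for v
    using not_less_Least[of v "\<lambda>v. n \<le> v \<and> 0 < \<pi> v"] that by (simp add: w_def)
  then have "s n ! n = s w ! w" using w(1) by (intro last_zeros)
  then show ?thesis using \<sigma>_pos[OF w(2)] True by (simp add: next_pos_def w_def)
next
  case False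
  then have "next_pos \<pi> n = \<infinity>" unfolding next_pos_def by (rule if_not_P)
  then show ?thesis using \<sigma>_inf[of n] False by simp
qed

lemma derived_eq: "derived \<sigma> \<pi> n = s n"
proof (rule nth_equalityI)
  show "length (derived \<sigma> \<pi> n) = length (s n)" by (simp add: derived_def len)
  fix i assume "i < length (derived \<sigma> \<pi> n)"
  then have "i < n \<or> i = n" by (auto simp: derived_def split: if_splits)
  then show "derived \<sigma> \<pi> n ! i = s n ! i"
    using \<sigma>_nth \<sigma>_pos \<sigma>_next_pos by (auto simp: derived_def nth_append simp del: upt_Suc)
qed

lemma compatible: "compatible \<sigma> \<pi>"
  unfolding compatible_def
proof (intro conjI allI impI)
  have le: "s n ! i \<le> i" if "i < Suc n" for n i using seqs[of n] that by (simp add: seqs_def)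
  have "\<sigma> i \<le> i" for i
    by (cases i) (use \<sigma>_fin nth_sminus le in auto)
  then show "\<sigma> \<in> seqs_omega1" by (simp add: seqs_omega1_def)
  show "\<sigma> (next_pos \<pi> (Suc k)) = enat (Suc k) \<longleftrightarrow> \<pi> k = \<infinity>" for k
    unfolding \<sigma>_next_pos full_iff[symmetric] by (simp add: full_def last_s len)
  show "\<sigma> (next_pos \<pi> n) \<le> enat n" for n
    unfolding \<sigma>_next_pos by (simp add: le)
qed

end

text \<open>The index of the component of \<open>\<A>(s\<^sub>n\<^sub>+\<^sub>1)\<close> onto which \<open>\<A>(s\<^sub>n)\<close> is mapped.\<close>

definition pos :: "nat \<Rightarrow> int" where
  "pos n = (if \<pi> n = \<infinity> then 0 else int (the_enat (\<pi> n)))"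

lemma pos_idx: "pos n \<in> idx (s (Suc n))"
  by (simp add: pos_def idx_def full_iff)

lemma sub_pos: "sub (s (Suc n)) (pos n) = s n"
  using step[of n] full_iff[of n] by (cases "\<pi> n") (auto simp: sub_def pos_def zero_enat_def)

lemma len2: "2 \<le> length (s (Suc n))"
  by (simp add: len)

lemmas s_grading = fin_chain_ranked_grading(2)[OF len] and s_image = fin_chain_ranked_grading(3)[OF len]

lemma rho_enat: "rho r (enat n) = rho_nat r n"
  by (simp add: rho_def)

lemma embedding_system_exists:
  assumes d: "derived \<sigma> \<pi> = s"
  shows "\<exists>e. embedding_system \<sigma> \<pi> e"
proof
  let ?e = "\<lambda>n a. pt (s (Suc n)) a (pos n)"
  show "embedding_system \<sigma> \<pi> ?e"
    unfolding embedding_system_def d Let_def rho_enat quot_chain_def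
  proof (intro allI conjI impI)
    fix n
    let ?B = "fin_chain (s (Suc n))"
    let ?C = "?e n ` Field (fin_chain (s n))"
    have C: "?C = fibre ?B pidx (pos n)"
      using fin_chain_fibre[OF len2 pos_idx] unfolding sub_pos by simp
    show "iso (fin_chain (s n)) (Restr ?B ?C) (?e n)"
      using fin_chain_fibre_iso[OF len2 pos_idx] unfolding sub_pos C .
    have "pos n \<in> pidx ` Field ?B" using pos_idx s_image by simp
    then obtain y where y: "y \<in> Field ?B" "pidx y = pos n" by force
    have Cy: "?C = rho_nat ?B n `` {y}"
      unfolding C grading_class[OF rho_cond[OF fin_chain_linear] s_grading y(1)] y(2) ..
    then show "?C \<in> Field ?B // rho_nat ?B n" using y(1) by (simp add: quotientI)
    show "quot ?B (rho_nat ?B n) \<simeq> int_chain" if "\<pi> n = \<infinity>"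
      using grading_int[OF fin_chain_linear rho_cond[OF fin_chain_linear] s_grading] that s_image full_iff
      by (simp add: idx_def)
    show "?C = (\<lambda>a. InZ a 0) ` Field (fin_chain (sminus (s (Suc n))))" if "\<pi> n = \<infinity>"
      using that full_iff[of n] step[of n] by (simp add: pt_def pos_def)
    assume fin: "\<pi> n < \<infinity>"
    then have "pidx ` Field ?B = {0..}" using s_image full_iff[of n] by (simp add: idx_def)
    note N = grading_nat[OF fin_chain_linear rho_cond[OF fin_chain_linear] s_grading this]
    show "quot ?B (rho_nat ?B n) \<simeq> natLeq" by (rule N(1))
    show "finite (underS (quot ?B (rho_nat ?B n)) ?C)" unfolding Cy by (rule N(2)[OF y(1)])
    show "enat (card (underS (quot ?B (rho_nat ?B n)) ?C)) = \<pi> n"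
      unfolding Cy N(3)[OF y(1)] y(2) using fin by (auto simp: pos_def)
  qed
qed

lemma embedding_system_image:
  assumes d: "derived \<sigma> \<pi> = s" and e: "embedding_system \<sigma> \<pi> e"
  shows "iso (fin_chain (s n)) (Restr (fin_chain (s (Suc n))) (fibre (fin_chain (s (Suc n))) pidx (pos n))) (e n)"
proof -
  let ?B = "fin_chain (s (Suc n))"
  let ?C = "e n ` Field (fin_chain (s n))"
  have E: "?C \<in> Field ?B // rho_nat ?B n" "iso (fin_chain (s n)) (Restr ?B ?C) (e n)"
    "\<pi> n < \<infinity> \<Longrightarrow> enat (card (underS (quot ?B (rho_nat ?B n)) ?C)) = \<pi> n"
    "\<pi> n = \<infinity> \<Longrightarrow> ?C = (\<lambda>a. InZ a 0) ` Field (fin_chain (sminus (s (Suc n))))"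
    using e unfolding embedding_system_def d Let_def rho_enat quot_chain_def by blast+
  have "?C = fibre ?B pidx (pos n)"
  proof (cases "\<pi> n = \<infinity>")
    case True
    then show ?thesis
      using E(4) fin_chain_fibre[OF len2 pos_idx[of n]] full_iff[of n] unfolding sub_pos
      by (simp add: pt_def pos_def step[of n])
  next
    case False
    then have "pidx ` Field ?B = {0..}" using s_image full_iff[of n] by (simp add: idx_def)
    note N = grading_nat[OF fin_chain_linear rho_cond[OF fin_chain_linear] s_grading this]
    obtain y where y: "y \<in> Field ?B" "?C = rho_nat ?B n `` {y}" using E(1) by (auto elim: quotientE)
    have "0 \<le> pidx y" using y(1) \<open>pidx ` Field ?B = {0..}\<close> by auto
    moreover have "enat (nat (pidx y)) = \<pi> n" using E(3) False N(3)[OF y(1)] y(2) by simp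
    ultimately have "pidx y = pos n" by (auto simp: pos_def)
    then show ?thesis
      using grading_class[OF rho_cond[OF fin_chain_linear] s_grading y(1)] y(2) by simp
  qed
  then show ?thesis using E(2) by simp
qed

end

section \<open>Direct limits and the representation\<close>

text \<open>The chain obtained from a preorder that is pulled back along a surjection \<open>F\<close> from \<open>P\<close> to \<open>r\<close>.\<close>

lemma quot_pullback:
  assumes r: "Linear_order r" and im: "F ` P = Field r"
  shows "quot {(p, q). p \<in> P \<and> q \<in> P \<and> (F p, F q) \<in> r} {(p, q). p \<in> P \<and> q \<in> P \<and> F p = F q} \<simeq> r"
    (is "quot ?R ?E \<simeq> r")
proof -
  define fib where "fib z = {p \<in> P. F p = z}" for z
  have FR: "Field ?R = P"
  proof
    show "P \<subseteq> Field ?R"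
    proof
      fix p assume "p \<in> P"
      then have "(p, p) \<in> ?R" using im lin_refl[OF r] by auto
      then show "p \<in> Field ?R" by (rule FieldI1)
    qed
  qed (auto simp: Field_def)
  have cl: "?E `` {p} = fib (F p)" if "p \<in> P" for p using that by (auto simp: fib_def)
  have ne: "\<exists>p\<in>P. F p = z" if "z \<in> Field r" for z using that im by force
  have q: "P // ?E = fib ` Field r"
  proof (intro set_eqI iffI)
    fix X assume "X \<in> P // ?E"
    then obtain p where "p \<in> P" "X = ?E `` {p}" by (rule quotientE)
    then show "X \<in> fib ` Field r" using cl im by auto
  next
    fix X assume "X \<in> fib ` Field r"
    then obtain p where "p \<in> P" "X = fib (F p)" using ne by auto
    then show "X \<in> P // ?E" using cl by (metis (no_types, lifting) quotientI)
  qed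
  have le: "(fib x, fib y) \<in> quot ?R ?E \<longleftrightarrow> (x, y) \<in> r" if xy: "x \<in> Field r" "y \<in> Field r" for x y
  proof -
    obtain p p' where "p \<in> P" "F p = x" "p' \<in> P" "F p' = y" using ne xy by metis
    then have "(\<exists>p\<in>fib x. \<exists>p'\<in>fib y. (p, p') \<in> ?R) \<longleftrightarrow> (x, y) \<in> r"
      by (auto simp: fib_def)
    then show ?thesis using xy by (simp add: quot_def FR q)
  qed
  have FQ: "Field (quot ?R ?E) = fib ` Field r"
  proof
    show "Field (quot ?R ?E) \<subseteq> fib ` Field r"
      unfolding Field_def[of "quot ?R ?E"] unfolding quot_def FR q by blast
    show "fib ` Field r \<subseteq> Field (quot ?R ?E)"
      using le lin_refl[OF r] by (auto intro: FieldI1)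
  qed
  have "iso r (quot ?R ?E) fib"
  proof (rule isoI)
    have "inj_on fib (Field r)"
      by (rule inj_onI) (use ne in \<open>force simp: fib_def\<close>)
    then show "bij_betw fib (Field r) (Field (quot ?R ?E))" using FQ by (simp add: bij_betw_def)
  qed (use le in simp)
  then show ?thesis by (rule chain_iso_sym[OF chain_isoI])
qed

lemma dir_lim_iso:
  assumes r: "Linear_order r"
    and f: "\<And>n. iso (A n) (Restr r (X n)) (f n)"
    and X: "\<And>n. X n \<subseteq> Field r" "(\<Union>n. X n) = Field r"
    and e: "\<And>n a. a \<in> Field (A n) \<Longrightarrow> e n a \<in> Field (A (Suc n))"
    and fe: "\<And>n a. a \<in> Field (A n) \<Longrightarrow> f (Suc n) (e n a) = f n a"
  shows "dir_lim A e \<simeq> r"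
proof -
  define P where "P = {(n, a). a \<in> Field (A n)}"
  define F where "F = (\<lambda>(n, a). f n a)"
  have FX: "Field (Restr r (X n)) = X n" for n using Field_Restr[OF r] X by blast
  have push: "push e m d a \<in> Field (A (m + d)) \<and> f (m + d) (push e m d a) = f m a"
    if "a \<in> Field (A m)" for m d a
    by (induction d) (use that e fe in auto)
  have push': "push e m (k - m) a \<in> Field (A k)" "f k (push e m (k - m) a) = f m a"
    if "a \<in> Field (A m)" "m \<le> k" for m k a
    using push[OF that(1), of "k - m"] that(2) by auto
  have inX: "f n a \<in> X n" if "a \<in> Field (A n)" for n a using iso_in[OF f that] unfolding FX .
  have fr: "(f k a, f k b) \<in> r \<longleftrightarrow> (a, b) \<in> A k" "f k a = f k b \<longleftrightarrow> a = b"
    if "a \<in> Field (A k)" "b \<in> Field (A k)" for k a b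
    using iso_le[OF f that] iso_eq[OF f that] inX that by auto
  have P_le: "(\<exists>k. m \<le> k \<and> n \<le> k \<and> (push e m (k - m) a, push e n (k - n) b) \<in> A k) \<longleftrightarrow> (f m a, f n b) \<in> r"
    and P_eq: "(\<exists>k. m \<le> k \<and> n \<le> k \<and> push e m (k - m) a = push e n (k - n) b) \<longleftrightarrow> f m a = f n b"
    if ab: "a \<in> Field (A m)" "b \<in> Field (A n)" for m n a b
  proof -
    have *: "(push e m (k - m) a, push e n (k - n) b) \<in> A k \<longleftrightarrow> (f m a, f n b) \<in> r"
      "push e m (k - m) a = push e n (k - n) b \<longleftrightarrow> f m a = f n b" if "m \<le> k" "n \<le> k" for k
      using fr[OF push'(1)[OF ab(1) that(1)] push'(1)[OF ab(2) that(2)]] push'(2) ab that by simp_all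
    show "(\<exists>k. m \<le> k \<and> n \<le> k \<and> (push e m (k - m) a, push e n (k - n) b) \<in> A k) \<longleftrightarrow> (f m a, f n b) \<in> r"
      "(\<exists>k. m \<le> k \<and> n \<le> k \<and> push e m (k - m) a = push e n (k - n) b) \<longleftrightarrow> f m a = f n b"
      using * by (meson nat_le_linear order_refl)+
  qed
  have "{((m, x), (n, y)) | m x n y. x \<in> Field (A m) \<and> y \<in> Field (A n) \<and>
        (\<exists>k. m \<le> k \<and> n \<le> k \<and> (push e m (k - m) x, push e n (k - n) y) \<in> A k)}
      = {(p, q). p \<in> P \<and> q \<in> P \<and> (F p, F q) \<in> r}"
    by (auto simp: P_def F_def P_le[symmetric])
  moreover have "{((m, x), (n, y)) | m x n y. x \<in> Field (A m) \<and> y \<in> Field (A n) \<and>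
        (\<exists>k. m \<le> k \<and> n \<le> k \<and> push e m (k - m) x = push e n (k - n) y)}
      = {(p, q). p \<in> P \<and> q \<in> P \<and> F p = F q}"
    by (auto simp: P_def F_def P_eq[symmetric])
  moreover have "F ` P = Field r"
  proof
    show "F ` P \<subseteq> Field r" using inX X by (auto simp: P_def F_def)
    show "Field r \<subseteq> F ` P"
    proof
      fix z assume "z \<in> Field r"
      then obtain n where "z \<in> X n" using X(2) by blast
      then obtain a where "a \<in> Field (A n)" "z = f n a" using iso_surj[OF f] FX by metis
      then have "z = F (n, a)" "(n, a) \<in> P" by (auto simp: P_def F_def)
      then show "z \<in> F ` P" by (rule image_eqI)
    qed
  qed
  ultimately show ?thesis unfolding dir_lim_def using quot_pullback[OF r] by simp
qed

context uniform_omega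
begin

lemma linked: "x \<in> Field r \<Longrightarrow> linked_sequence (type_seq r x) (emb_seq r x)"
proof
  fix n
  assume x: "x \<in> Field r"
  show "type_seq r x n \<in> seqs (Suc n)" by (rule type_seq(1)[OF x])
  show "type_seq r x n = (if 0 < emb_seq r x n then sminus (type_seq r x (Suc n))
    else splus (type_seq r x (Suc n)))"
    using type_seq_step(1,3)[OF x refl, of n] by simp
  show "full (type_seq r x (Suc n)) \<longleftrightarrow> emb_seq r x n = \<infinity>"
    by (rule type_seq_step(2)[OF x refl])
qed

text \<open>The isomorphisms of \<open>\<A>(s\<^sub>n)\<close> with the \<open>n\<close>-component of \<open>x\<close> can be extended along the embeddings,
  one component at a time.\<close>

lemma extend_iso:
  assumes x: "x \<in> Field r"
  defines "s \<equiv> type_seq r x" and "\<pi> \<equiv> emb_seq r x"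
  assumes f: "iso (fin_chain (s n)) (cchain n x) f"
    and e: "iso (fin_chain (s n)) (Restr (fin_chain (s (Suc n)))
      (fibre (fin_chain (s (Suc n))) pidx (linked_sequence.pos \<pi> n))) e"
  shows "\<exists>f'. iso (fin_chain (s (Suc n))) (cchain (Suc n) x) f' \<and>
    (\<forall>a\<in>Field (fin_chain (s n)). f' (e a) = f a)"
proof -
  interpret L: linked_sequence s \<pi> using linked[OF x] by (simp add: s_def \<pi>_def)
  let ?S = "s (Suc n)" and ?D = "cchain (Suc n) x" and ?K = "L.pos n"
  let ?B = "fin_chain ?S"
  obtain h where h: "grading ?D (rho_nat ?D n) h" "h ` comp (Suc n) x = idx ?S"
    and fib: "\<And>k. k \<in> idx ?S \<Longrightarrow> Restr ?D (fibre ?D h k) \<simeq> fin_chain (sub ?S k)"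
    and hx: "\<pi> n \<noteq> \<infinity> \<Longrightarrow> \<pi> n = enat (nat (h x))"
    using type_seq_step(4)[OF x refl, of n] unfolding s_def \<pi>_def by blast
  have xD: "x \<in> Field ?D" using comp_self[OF x] Field_cchain by blast
  \<comment> \<open>If the set of indices is \<open>\<int>\<close>, then it is shifted so that \<open>x\<close> gets the index of the image of \<open>e\<close>;
    otherwise \<open>c = 0\<close>.\<close>
  define c where "c = h x - ?K"
  define h' where "h' y = h y - c" for y
  have c0: "c = 0" if "\<not> full ?S"
  proof -
    have "h x \<in> idx ?S" using h(2) comp_self[OF x] by blast
    then have "0 \<le> h x" using that by (simp add: idx_def)
    moreover have "\<pi> n \<noteq> \<infinity>" using that L.full_iff by blast
    ultimately show ?thesis using hx by (simp add: c_def L.pos_def)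
  qed
  have h': "grading ?D (rho_nat ?D n) h'" using h(1) by (simp add: grading_def h'_def)
  have im: "h' ` Field ?D = idx ?S"
  proof (cases "full ?S")
    case True
    have "h' ` Field ?D = (\<lambda>k. k - c) ` (h ` Field ?D)" by (simp add: h'_def image_image)
    then show ?thesis using True h(2) unfolding Field_cchain
      by (simp add: idx_def)
  next
    case False
    then show ?thesis using h(2) c0 by (simp add: h'_def Field_cchain)
  qed
  have fib': "Restr ?D (fibre ?D h' k) \<simeq> fin_chain (sub ?S k)" if "k \<in> idx ?S" for k
  proof -
    have *: "fibre ?D h' k = fibre ?D h (k + c)" by (auto simp: h'_def)
    have i: "k + c \<in> idx ?S" and "sub ?S (k + c) = sub ?S k"
      using that c0 by (auto simp: idx_def sub_def)
    then show ?thesis using fib[OF i] unfolding * by simp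
  qed
  have h'x: "h' x = ?K" by (simp add: h'_def c_def)
  have fx: "Restr ?D (fibre ?D h' ?K) = cchain n x"
  proof -
    have "fibre ?D h' ?K = comp n x"
      using grading_class[OF rho_cond[OF cchain_linear] h' xD] cchain_class(1)[OF comp_self[OF x]] h'x
      by simp
    then show ?thesis using cchain_class(2)[OF comp_self[OF x]] by simp
  qed
  have l2: "2 \<le> length ?S" by (rule L.len2)
  let ?g = "f \<circ> inv_into (Field (fin_chain (s n))) e"
  have "\<exists>g. iso (Restr ?B (fibre ?B pidx k)) (Restr ?D (fibre ?D h' k)) g \<and> (k = ?K \<longrightarrow> g = ?g)"
    if "k \<in> idx ?S" for k
  proof (cases "k = ?K")
    case True
    have "iso (Restr ?B (fibre ?B pidx ?K)) (cchain n x) ?g"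
      by (rule iso_comp[OF iso_inv[OF e] f])
    then show ?thesis using True fx by simp
  next
    case False
    have "Restr ?B (fibre ?B pidx k) \<simeq> Restr ?D (fibre ?D h' k)"
      by (rule chain_iso_trans[OF chain_iso_sym[OF chain_isoI[OF fin_chain_fibre_iso[OF l2 that]]]
        chain_iso_sym[OF fib'[OF that]]])
    then show ?thesis using False by (auto simp: chain_iso_def)
  qed
  then have "\<forall>k\<in>idx ?S. \<exists>g. iso (Restr ?B (fibre ?B pidx k)) (Restr ?D (fibre ?D h' k)) g \<and>
      (k = ?K \<longrightarrow> g = ?g)" by blast
  from bchoice[OF this] obtain G where
    "\<forall>k\<in>idx ?S. iso (Restr ?B (fibre ?B pidx k)) (Restr ?D (fibre ?D h' k)) (G k) \<and>
      (k = ?K \<longrightarrow> G k = ?g)" ..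
  then have G: "\<And>k. k \<in> idx ?S \<Longrightarrow> iso (Restr ?B (fibre ?B pidx k)) (Restr ?D (fibre ?D h' k)) (G k)"
    and GK: "\<And>k. k \<in> idx ?S \<Longrightarrow> k = ?K \<Longrightarrow> G k = ?g" by blast+
  have "iso ?B ?D (\<lambda>p. G (pidx p) p)"
  proof (rule glue(1)[OF fin_chain_linear L.s_grading cchain_linear h'])
    show "pidx ` Field ?B = h' ` Field ?D" using im L.s_image by simp
  qed (use G L.s_image in blast)
  moreover have "G (pidx (e a)) (e a) = f a" if a: "a \<in> Field (fin_chain (s n))" for a
  proof -
    have "e a \<in> fibre ?B pidx ?K"
      using iso_in[OF e a] Field_Restr[OF fin_chain_linear] by auto
    then have "pidx (e a) = ?K" by simp
    then show ?thesis
      using GK[OF L.pos_idx refl] bij_betw_inv_into_left[OF iso_bij[OF e] a] by simp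
  qed
  ultimately show ?thesis by (intro exI[of _ "\<lambda>p. G (pidx p) p"]) blast
qed

lemma pair_chain_iso:
  assumes x: "x \<in> Field r" and d: "derived \<sigma> (emb_seq r x) = type_seq r x"
  shows "r \<simeq> pair_chain \<sigma> (emb_seq r x)"
proof -
  define s \<pi> where "s = type_seq r x" and "\<pi> = emb_seq r x"
  interpret L: linked_sequence s \<pi> using linked[OF x] by (simp add: s_def \<pi>_def)
  have d': "derived \<sigma> \<pi> = s" using d by (simp add: s_def \<pi>_def)
  define e where "e = (SOME e. embedding_system \<sigma> \<pi> e)"
  have "embedding_system \<sigma> \<pi> e"
    unfolding e_def by (rule someI_ex[OF L.embedding_system_exists[OF d']])
  note E = L.embedding_system_image[OF d' this]
  let ?A = "\<lambda>n. fin_chain (s n)"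
  have "\<exists>f. \<forall>n. iso (?A n) (cchain n x) (f n) \<and> (\<forall>a\<in>Field (?A n). f (Suc n) (e n a) = f n a)"
  proof (rule dependent_nat_choice)
    show "\<exists>f. iso (?A 0) (cchain 0 x) f"
      using type_seq(2)[OF x] chain_iso_sym unfolding chain_iso_def[symmetric] s_def by blast
    fix f n assume "iso (?A n) (cchain n x) f"
    then show "\<exists>f'. iso (?A (Suc n)) (cchain (Suc n) x) f' \<and> (\<forall>a\<in>Field (?A n). f' (e n a) = f a)"
      using extend_iso[OF x, of n f "e n"] E[of n] unfolding s_def \<pi>_def by blast
  qed
  then obtain f where f: "\<And>n. iso (?A n) (cchain n x) (f n)"
    and fe: "\<And>n a. a \<in> Field (?A n) \<Longrightarrow> f (Suc n) (e n a) = f n a" by blast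
  have "dir_lim ?A e \<simeq> r"
  proof (rule dir_lim_iso[OF lin f])
    show "comp n x \<subseteq> Field r" for n by (rule rho_class_Field[OF lin])
    show "(\<Union>n. comp n x) = Field r"
    proof
      show "(\<Union>n. comp n x) \<subseteq> Field r" using rho_class_Field[OF lin] by (rule UN_least)
      show "Field r \<subseteq> (\<Union>n. comp n x)" using rho_omega_total[OF x] by fast
    qed
    show "e n a \<in> Field (?A (Suc n))" if "a \<in> Field (?A n)" for n a
      using iso_in[OF E that] Field_Restr[OF fin_chain_linear] by auto
  qed (rule fe)
  then show ?thesis
    using chain_iso_sym unfolding pair_chain_def \<pi>_def[symmetric] d' e_def by blast
qed

lemma representation:
  assumes x: "x \<in> Field r"
  shows "compatible (trunk r x) (emb_seq r x)" "r \<simeq> pair_chain (trunk r x) (emb_seq r x)"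
proof -
  let ?s = "type_seq r x" and ?\<pi> = "emb_seq r x"
  interpret L: linked_sequence ?s ?\<pi> by (rule linked[OF x])
  have fin: "trunk r x (enat k) = enat (sminus (?s (Suc k)) ! k)" for k
    by (simp add: trunk_def)
  have inf: "trunk r x \<infinity> = enat (?s m ! m)" if m: "\<forall>n\<ge>m. ?\<pi> n = 0" for m
  proof -
    define m0 where "m0 = (LEAST m. \<forall>n\<ge>m. ?\<pi> n = 0)"
    have "\<forall>n\<ge>m0. ?\<pi> n = 0" unfolding m0_def by (rule LeastI[of "\<lambda>m. \<forall>n\<ge>m. ?\<pi> n = 0" m, OF m])
    moreover have "m0 \<le> m" unfolding m0_def by (rule Least_le[of "\<lambda>m. \<forall>n\<ge>m. ?\<pi> n = 0" m, OF m])
    ultimately have "?s m0 ! m0 = ?s m ! m" by (intro L.last_zeros) auto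
    then show ?thesis using m by (auto simp: trunk_def m0_def Let_def)
  qed
  show "compatible (trunk r x) ?\<pi>" by (rule L.compatible[OF fin inf])
  show "r \<simeq> pair_chain (trunk r x) ?\<pi>"
    by (rule pair_chain_iso[OF x]) (intro ext L.derived_eq[OF fin inf])
qed

end

theorem mainTheorem5:
  fixes r :: "'a rel"
  assumes "Linear_order r" and "uniform_chain r" and "has_rank r \<infinity>"
  shows "(\<exists>\<sigma> \<pi>. compatible \<sigma> \<pi> \<and> r \<simeq> pair_chain \<sigma> \<pi>) \<and>
         (\<forall>\<sigma> \<pi>. (\<exists>x\<in>Field r. \<sigma> = trunk r x \<and> \<pi> = emb_seq r x) \<longrightarrow>
            compatible \<sigma> \<pi> \<and> r \<simeq> pair_chain \<sigma> \<pi>)"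
proof -
  interpret uniform_omega r using assms by unfold_locales
  show ?thesis using representation Field_nonempty by blast
qed

end
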